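(* Let $C_\lambda,C_\gamma\subset\mathbb{R}$ be affine Cantor sets with similarity dimensions $d_\lambda,d_\gamma$, respectively. Let $\mathcal{IP}$ be the set of angles $\theta\in[0,\pi)$ such that the orthogonal projection $\Pi_\theta$ is not one-to-one on $C_\lambda\times C_\gamma\subset\mathbb{R}^2$. Then $\mathcal{H}^{d_\lambda+d_\gamma}(\Pi_\theta(C_\lambda\times C_\gamma))=0$ for Lebesgue almost all $\theta\in\mathcal{IP}$.
   Context: An affine Cantor set in $\mathbb{R}$ is the attractor of a finite iterated function system of affine contractions. Here $C_\lambda$ is the attractor of $F_i(x)=O^\lambda_i\lambda_i x+b_i$ ($1\le i\le A$) and $C_\gamma$ is the attractor of $G_j(x)=O^\gamma_j\gamma_j x+c_j$ ($1\le j\le B$), with $O^\lambda_i,O^\gamma_j\in\{+1,-1\}$, $0<\lambda_i,\gamma_j<1$, $b_i,c_j\in\mathbb{R}$. The similarity dimensions are the real numbers with $\sum_{i=1}^A\lambda_i^{d_\lambda}=1$ and $\sum_{j=1}^B\gamma_j^{d_\gamma}=1$. $\Pi_\theta$ denotes the orthogonal projection from $\mathbb{R}^2$ onto the line $l_\theta$ through the origin making angle $\theta$ with the positive $x$-axis. $\mathcal{H}^s$ is $s$-dimensional Hausdorff measure. *)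

theory Defs
  imports "HOL-Analysis.Analysis"
begin

text \<open>
  Hausdorff measure as an outer measure on all subsets of a metric space, without a normalising
  constant.  The summand contributed by a covering set U is diam(U)^s, with the usual conventions
  that the empty set contributes 0 and that 0^0 = 1 (so that the 0-dimensional measure is counting
  measure); these have to be spelled out because \<^term>\<open>0 powr 0 = (0::real)\<close>.  The boundedness
  requirement in the covers is needed because \<^const>\<open>diameter\<close> is unspecified on unbounded sets.
\<close>

definition diam_pow :: "real \<Rightarrow> 'a::metric_space set \<Rightarrow> ennreal" where
  "diam_pow s U = (if U = {} then 0 else if s = 0 then 1 else ennreal (diameter U powr s))"

definition delta_covers :: "real \<Rightarrow> 'a::metric_space set \<Rightarrow> (nat \<Rightarrow> 'a set) set" where
  "delta_covers \<delta> E = {U. E \<subseteq> (\<Union>n. U n) \<and> (\<forall>n. bounded (U n) \<and> diameter (U n) \<le> \<delta>)}"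

definition hausdorff_premeasure :: "real \<Rightarrow> real \<Rightarrow> 'a::metric_space set \<Rightarrow> ennreal" where
  "hausdorff_premeasure s \<delta> E = (INF U \<in> delta_covers \<delta> E. \<Sum>n. diam_pow s (U n))"

definition hausdorff_measure :: "real \<Rightarrow> 'a::metric_space set \<Rightarrow> ennreal" where
  "hausdorff_measure s E = (SUP \<delta> \<in> {0<..}. hausdorff_premeasure s \<delta> E)"

definition is_attractor :: "'i set \<Rightarrow> ('i \<Rightarrow> 'a::metric_space \<Rightarrow> 'a) \<Rightarrow> 'a set \<Rightarrow> bool" where
  "is_attractor I F K \<longleftrightarrow> compact K \<and> K \<noteq> {} \<and> K = (\<Union>i\<in>I. F i ` K)"

text \<open>
  \<open>affine_cantor_set A sg r b d C\<close>: the set C is the attractor of the A maps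
  \<open>x \<mapsto> sg i * r i * x + b i\<close>, and d is the similarity dimension of this system.  The dimension
  belongs to the system rather than to C, so the two are kept together.
\<close>

definition affine_cantor_set ::
  "nat \<Rightarrow> (nat \<Rightarrow> real) \<Rightarrow> (nat \<Rightarrow> real) \<Rightarrow> (nat \<Rightarrow> real) \<Rightarrow> real \<Rightarrow> real set \<Rightarrow> bool" where
  "affine_cantor_set A sg r b d C \<longleftrightarrow>
     (\<forall>i\<in>{1..A}. sg i \<in> {1, -1} \<and> 0 < r i \<and> r i < 1) \<and>
     is_attractor {1..A} (\<lambda>i x. sg i * r i * x + b i) C \<and>
     (\<Sum>i=1..A. r i powr d) = 1"

definition line_at :: "real \<Rightarrow> (real \<times> real) set" where
  "line_at \<theta> = span {(cos \<theta>, sin \<theta>)}"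

definition proj_line :: "real \<Rightarrow> real \<times> real \<Rightarrow> real \<times> real" where
  "proj_line \<theta> x = (x \<bullet> (cos \<theta>, sin \<theta>)) *\<^sub>R (cos \<theta>, sin \<theta>)"

lemma proj_line_in_line: "proj_line \<theta> x \<in> line_at \<theta>"
  unfolding proj_line_def line_at_def by (intro span_scale span_base) simp

lemma proj_line_orthogonal:
  assumes "y \<in> line_at \<theta>"
  shows "orthogonal (x - proj_line \<theta> x) y"
proof -
  obtain k where y: "y = k *\<^sub>R (cos \<theta>, sin \<theta>)"
    using assms unfolding line_at_def span_singleton by auto
  have "(cos \<theta>, sin \<theta>) \<bullet> (cos \<theta>, sin \<theta>) = 1"
    by (simp flip: power2_eq_square)
  then show ?thesis
    unfolding y orthogonal_def proj_line_def inner_diff_left inner_scaleR_left inner_scaleR_right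
    by simp
qed

definition non_injective_angles :: "real set \<Rightarrow> real set \<Rightarrow> real set" where
  "non_injective_angles C D = {\<theta> \<in> {0..<pi}. \<not> inj_on (proj_line \<theta>) (C \<times> D)}"

end

theory Submission
  imports Defs
begin

text \<open>
  Put \<open>t = tan \<theta>\<close> and \<open>s = d1 + d2\<close>.  Up to a factor of modulus at most 1, the projection onto the line at
  angle \<open>\<theta>\<close> is \<open>(x, y) \<mapsto> x + t * y\<close>.  A pair \<open>(u, w)\<close> of finite words describes a cylinder of the product
  \<open>C1 \<times> C2\<close>; its weight is the product of the \<open>d1\<close>-th and the \<open>d2\<close>-th power of the two contraction ratios, so
  that the weights of each generation add up to 1.  Covering the projections of approximately square
  cylinders by single intervals costs a bounded amount per unit of weight, hence the \<open>s\<close>-dimensional measure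
  is finite.  It vanishes as soon as many cylinders pile up in the projection.  This is measured by
  calling \<open>t\<close> \<open>\<epsilon>\<close>-clustered if some disjoint cylinders project into one interval \<open>J\<close> with
  \<open>length J ^ s < \<epsilon> * (their total weight)\<close>.  Disjointness of cylinders always refers to the addresses
  that they contain, since the pieces of \<open>C1\<close> and of \<open>C2\<close> may overlap.  Two facts carry the proof.

  If \<open>t\<close> is \<open>\<epsilon>\<close>-clustered, then the projection has covers of cost \<open>3 * \<epsilon>\<close> by arbitrarily short intervals
  (\<open>clustered_coverable\<close>).  The projection of the cylinder \<open>(u, w)\<close> is a similar copy of the projection of
  the whole product at the parameter \<open>t * (slope w / slope u)\<close>.  Appending suitable words brings this
  parameter back to nearly \<open>t\<close> (\<open>return_words\<close>, by Dirichlet's approximation theorem), and for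
  approximately square cylinders finitely many such words suffice.  As being clustered is an open
  condition, a copy of the cluster of \<open>t\<close> occupies a fixed proportion of the weight of every cylinder and can
  be covered cheaply; repeating this in the remaining cylinders improves the cost to \<open>2 * \<epsilon>\<close> in the limit.

  If \<open>t0\<close> is \<open>\<epsilon>\<close>-clustered and two distinct points have the same projection at \<open>t0\<close>, then at arbitrarily small
  scales around \<open>t0\<close> a fixed proportion of the parameters is \<open>2/3 * \<epsilon>\<close>-clustered (\<open>clustered_porous\<close>).  There
  are small disjoint cylinders near the two points with almost equal slopes (\<open>aligned_words\<close>), each containing
  a copy of the cluster, and a small change of the parameter moves the two copies on top of each other, which
  doubles the weight and nearly preserves the length of the interval (\<open>clustered_double\<close>).

  Hence the set of parameters of non-injectivity that are \<open>\<epsilon>\<close>-clustered but not \<open>2/3 * \<epsilon>\<close>-clustered is porous,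
  so it is a null set (\<open>porous_negligible\<close>, by Vitali's covering theorem).  Each parameter is \<open>\<epsilon>\<close>-clustered for
  some \<open>\<epsilon>\<close>, so almost every parameter of non-injectivity is \<open>\<epsilon>\<close>-clustered for arbitrarily small \<open>\<epsilon>\<close>, and the
  projection has measure zero there.
\<close>

section \<open>Porous sets of real numbers are null\<close>

lemma emeasure_lebesgue_ball_real:
  fixes a r :: real assumes "0 \<le> r"
  shows "emeasure lebesgue (ball a r) = ennreal (2 * r)"
  using assms by (simp add: ball_eq_greaterThanLessThan)

text \<open>
  If every point of \<open>S\<close> sees, at arbitrarily small scales, a hole of \<open>S\<close> filling the fixed proportion
  \<open>k\<close> of a ball around it, then covering \<open>S\<close> by disjoint such balls inside an almost optimal open
  superset multiplies its outer measure by \<open>1 - k\<close>.  Working with outer measure avoids any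
  measurability assumption on \<open>S\<close>.
\<close>
lemma uniformly_porous_bounded_negligible:
  fixes S :: "real set"
  assumes "bounded S" and k: "0 < k" "k < 1"
    and hole: "\<And>x d. x \<in> S \<Longrightarrow> 0 < d \<Longrightarrow>
      \<exists>r c. 0 < r \<and> r < d \<and> ball c (k * r) \<subseteq> ball x r \<and> ball c (k * r) \<inter> S = {}"
  shows "negligible S"
proof -
  \<comment> \<open>\<open>m\<close> is the Lebesgue outer measure of \<open>S\<close>\<close>
  define MM where "MM = {measure lebesgue T | T. S \<subseteq> T \<and> T \<in> lmeasurable}"
  define m where "m = Inf MM"
  obtain R where R: "S \<subseteq> ball 0 R"
    using \<open>bounded S\<close> by (metis bounded_subset_ballD)
  have ne: "MM \<noteq> {}" using R lmeasurable_ball unfolding MM_def by blast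
  have bdd: "bdd_below MM" unfolding MM_def by (rule bdd_belowI[of _ 0]) auto
  have m_le: "m \<le> measure lebesgue T" if "S \<subseteq> T" "T \<in> lmeasurable" for T
    unfolding m_def by (rule cInf_lower[OF _ bdd]) (use that in \<open>auto simp: MM_def\<close>)
  have step: "m \<le> (1 - k) * (m + e)" if e0: "0 < e" for e
  proof -
    obtain T where T: "S \<subseteq> T" "T \<in> lmeasurable" "measure lebesgue T < m + e / 2"
    proof -
      have "Inf MM < m + e / 2" using e0 by (simp add: m_def)
      from cInf_lessD[OF ne this] show ?thesis using that unfolding MM_def by blast
    qed
    obtain U where U: "open U" "T \<subseteq> U" "U \<in> lmeasurable" "measure lebesgue U < m + e"
    proof -
      have "0 < e / 2" using e0 by simp
      then obtain U where U: "open U" "T \<subseteq> U" "U - T \<in> lmeasurable"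
          "emeasure lebesgue (U - T) < ennreal (e / 2)"
        using sets_lebesgue_outer_open[OF fmeasurableD[OF T(2)]] by metis
      have UT: "U = T \<union> (U - T)" using U by auto
      then have Um: "U \<in> lmeasurable" using T(2) U(3) by (metis fmeasurable.Un)
      have "measure lebesgue (U - T) < e / 2"
        using U(3,4) e0 by (simp add: emeasure_eq_measure2 ennreal_less_iff)
      moreover have "measure lebesgue U \<le> measure lebesgue T + measure lebesgue (U - T)"
        using UT T(2) U(3) by (metis fmeasurableD measure_Un_le)
      ultimately show ?thesis using that U Um T(3) by force
    qed
    define K where "K = {(x, r, c). 0 < r \<and> ball x r \<subseteq> U \<and> ball c (k * r) \<subseteq> ball x r
      \<and> ball c (k * r) \<inter> S = {}}"
    have vit: "\<exists>i. i \<in> K \<and> x \<in> ball (fst i) (fst (snd i)) \<and> fst (snd i) < d" if x: "x \<in> S" "0 < d" for x d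
    proof -
      have "x \<in> U" using x T U by auto
      then obtain d' where d': "0 < d'" "ball x d' \<subseteq> U"
        using \<open>open U\<close> open_contains_ball by blast
      obtain r c where r: "0 < r" "r < min d d'" "ball c (k * r) \<subseteq> ball x r" "ball c (k * r) \<inter> S = {}"
        using hole[OF x(1), of "min d d'"] x(2) d'(1) by auto
      have "ball x r \<subseteq> U" using d'(2) r(2) by fastforce
      then show ?thesis using r by (intro exI[of _ "(x, r, c)"]) (auto simp: K_def)
    qed
    obtain C where C: "countable C" "C \<subseteq> K"
      "pairwise (\<lambda>i j. disjnt (ball (fst i) (fst (snd i))) (ball (fst j) (fst (snd j)))) C"
      "negligible (S - (\<Union>i\<in>C. ball (fst i) (fst (snd i))))"
      using Vitali_covering_theorem_balls[OF vit, of S] by blast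
    define B where "B = (\<lambda>i::real\<times>real\<times>real. ball (fst i) (fst (snd i)))"
    define H where "H = (\<lambda>i::real\<times>real\<times>real. ball (snd (snd i)) (k * fst (snd i)))"
    have Ki: "0 < fst (snd i)" "B i \<subseteq> U" "H i \<subseteq> B i" "H i \<inter> S = {}" if "i \<in> C" for i
    proof -
      have "i \<in> K" using that C(2) by blast
      then show "0 < fst (snd i)" "B i \<subseteq> U" "H i \<subseteq> B i" "H i \<inter> S = {}"
        unfolding K_def B_def H_def by (cases i; simp)+
    qed
    have djB: "disjoint_family_on B C"
      using C(3) unfolding disjoint_family_on_def pairwise_def disjnt_def B_def by auto
    then have djH: "disjoint_family_on H C"
      using Ki(3) unfolding disjoint_family_on_def by blast
    have sB: "B i \<in> sets lebesgue" "H i \<in> sets lebesgue" for i by (auto simp: B_def H_def)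
    define V where "V = (\<Union>i\<in>C. B i)"
    define W where "W = (\<Union>i\<in>C. H i)"
    have sV: "V \<in> sets lebesgue" "W \<in> sets lebesgue"
      unfolding V_def W_def using C(1) sB by (auto intro!: sets.countable_UN')
    have VU: "V \<subseteq> U" and WV: "W \<subseteq> V" and WS: "W \<inter> S = {}"
      unfolding V_def W_def using Ki by blast+
    have V: "V \<in> lmeasurable" using VU sV U(3) by (metis fmeasurableI2)
    have W: "W \<in> lmeasurable" using WV sV V by (metis fmeasurableI2)
    have "emeasure lebesgue W = (\<integral>\<^sup>+ i. emeasure lebesgue (H i) \<partial>count_space C)"
      unfolding W_def using sB C(1) djH by (intro emeasure_UN_countable) auto
    also have "\<dots> = (\<integral>\<^sup>+ i. ennreal k * emeasure lebesgue (B i) \<partial>count_space C)"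
    proof (rule nn_integral_cong)
      fix i assume "i \<in> space (count_space C)"
      then have "0 < fst (snd i)" using Ki(1) by auto
      then show "emeasure lebesgue (H i) = ennreal k * emeasure lebesgue (B i)"
        using k unfolding H_def B_def
        by (subst (1 2) emeasure_lebesgue_ball_real) (auto simp: ennreal_mult[symmetric] mult_ac)
    qed
    also have "\<dots> = ennreal k * (\<integral>\<^sup>+ i. emeasure lebesgue (B i) \<partial>count_space C)"
      by (rule nn_integral_cmult) auto
    also have "(\<integral>\<^sup>+ i. emeasure lebesgue (B i) \<partial>count_space C) = emeasure lebesgue V"
      unfolding V_def using sB C(1) djB by (intro emeasure_UN_countable[symmetric]) auto
    finally have mW: "measure lebesgue W = k * measure lebesgue V"
      using V W k by (simp add: emeasure_eq_measure2 ennreal_mult[symmetric])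
    define N where "N = S - V"
    have N: "negligible N" using C(4) unfolding N_def V_def B_def .
    then have N0: "N \<in> lmeasurable" "measure lebesgue N = 0"
      by (auto simp: negligible_iff_measure)
    have "m \<le> measure lebesgue ((V - W) \<union> N)"
      by (rule m_le) (use WS V W N0 in \<open>auto simp: N_def intro!: fmeasurable.Un fmeasurable.Diff\<close>)
    also have "\<dots> \<le> measure lebesgue (V - W) + measure lebesgue N"
      using V W N0 by (intro measure_Un_le) auto
    also have "measure lebesgue (V - W) = (1 - k) * measure lebesgue V"
      using V W WV mW by (simp add: measurable_measure_Diff algebra_simps)
    also have "\<dots> \<le> (1 - k) * (m + e)"
      using k U(3,4) V VU
      by (intro mult_left_mono) (auto intro: order.trans[OF measure_mono_fmeasurable] simp: fmeasurableD)
    finally show ?thesis using N0 by simp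
  qed
  have "m \<le> 0"
  proof (rule ccontr)
    assume "\<not> m \<le> 0"
    then have "m \<le> (1 - k) * (m + k * m)" using step[of "k * m"] k by simp
    also have "\<dots> = m - k * k * m" by (simp add: algebra_simps)
    finally show False using \<open>\<not> m \<le> 0\<close> k by (simp add: mult_le_0_iff)
  qed
  show ?thesis
  proof (rule negligible_outer_le[THEN iffD2], intro allI impI)
    fix e :: real assume "0 < e"
    then have "Inf MM < e" using \<open>m \<le> 0\<close> by (simp add: m_def)
    from cInf_lessD[OF ne this] obtain x where "x \<in> MM" "x < e" by blast
    then show "\<exists>T. S \<subseteq> T \<and> T \<in> lmeasurable \<and> measure lebesgue T \<le> e"
      unfolding MM_def by auto
  qed
qed

text \<open>
  The proportion of the hole may depend on the point: the set is a countable union of bounded sets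
  on which it does not.
\<close>
lemma porous_negligible:
  fixes S :: "real set"
  assumes hole: "\<And>x. x \<in> S \<Longrightarrow> \<exists>k>0. \<forall>d>0.
      \<exists>r c. 0 < r \<and> r < d \<and> ball c (k * r) \<subseteq> ball x r \<and> ball c (k * r) \<inter> S = {}"
  shows "negligible S"
proof -
  define h where "h = (\<lambda>n::nat. 1 / (real n + 2))"
  define P where "P = (\<lambda>n. {x \<in> S. \<bar>x\<bar> \<le> real n \<and> (\<forall>d>0.
      \<exists>r c. 0 < r \<and> r < d \<and> ball c (h n * r) \<subseteq> ball x r \<and> ball c (h n * r) \<inter> S = {})})"
  have "negligible (P n)" for n
  proof (rule uniformly_porous_bounded_negligible[where k = "h n"])
    show "bounded (P n)" unfolding bounded_iff P_def by auto
    show "0 < h n" "h n < 1" unfolding h_def by (simp_all add: field_simps)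
    show "\<exists>r c. 0 < r \<and> r < d \<and> ball c (h n * r) \<subseteq> ball x r \<and> ball c (h n * r) \<inter> P n = {}"
      if "x \<in> P n" "0 < d" for x d
    proof -
      obtain r c where r: "0 < r" "r < d" "ball c (h n * r) \<subseteq> ball x r" "ball c (h n * r) \<inter> S = {}"
        using \<open>x \<in> P n\<close> \<open>0 < d\<close> unfolding P_def by blast
      have "P n \<subseteq> S" unfolding P_def by blast
      then have "ball c (h n * r) \<inter> P n = {}" using r(4) by blast
      with r(1-3) show ?thesis by (intro exI conjI)
    qed
  qed
  then have "negligible (\<Union>n. P n)" by (rule negligible_Union_nat)
  moreover have "S \<subseteq> (\<Union>n. P n)"
  proof
    fix x assume x: "x \<in> S"
    obtain k where k: "0 < k" and kd: "\<And>d. 0 < d \<Longrightarrow>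
      \<exists>r c. 0 < r \<and> r < d \<and> ball c (k * r) \<subseteq> ball x r \<and> ball c (k * r) \<inter> S = {}"
      using hole[OF x] by blast
    obtain n :: nat where n: "\<bar>x\<bar> + 1 / k < n" using reals_Archimedean2 by blast
    have "0 < 1 / k" using k by simp
    with n have n': "\<bar>x\<bar> \<le> n" "1 / k < n" by linarith+
    have "h n \<le> k"
    proof -
      have "1 \<le> k * (real n + 2)" using n'(2) k by (simp add: field_simps)
      then show ?thesis unfolding h_def by (simp add: field_simps)
    qed
    have "\<exists>r c. 0 < r \<and> r < d \<and> ball c (h n * r) \<subseteq> ball x r \<and> ball c (h n * r) \<inter> S = {}"
      if d0: "0 < d" for d
    proof -
      obtain r c where r: "0 < r" "r < d" "ball c (k * r) \<subseteq> ball x r" "ball c (k * r) \<inter> S = {}"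
        using kd[OF d0] by blast
      have "ball c (h n * r) \<subseteq> ball c (k * r)"
        using \<open>h n \<le> k\<close> r(1) by (intro subset_ball mult_right_mono) auto
      then have "ball c (h n * r) \<subseteq> ball x r" "ball c (h n * r) \<inter> S = {}"
        using r(3,4) by blast+
      with r(1,2) show ?thesis by (intro exI conjI)
    qed
    then show "x \<in> (\<Union>n. P n)" using x n'(1) unfolding P_def by blast
  qed
  ultimately show ?thesis by (rule negligible_subset)
qed

section \<open>Finite covers and Hausdorff measure\<close>

text \<open>
  \<open>E\<close> has a finite cover by nondegenerate intervals of length at most \<open>\<delta>\<close>, at total cost at most
  \<open>M\<close> in the gauge \<open>length ^ s\<close>.  Finite covers with real costs suffice for all the covers used below,
  and positive lengths make the cost of an interval bound the summand \<^const>\<open>diam_pow\<close> for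
  \<open>s = 0\<close> too.
\<close>
definition coverable :: "real \<Rightarrow> real \<Rightarrow> real \<Rightarrow> real set \<Rightarrow> bool" where
  "coverable s \<delta> M E \<longleftrightarrow> (\<exists>xs. (\<forall>(c, l) \<in> set xs. 0 < l \<and> 2 * l \<le> \<delta>) \<and>
     E \<subseteq> (\<Union>(c, l) \<in> set xs. cball c l) \<and> (\<Sum>(c, l)\<leftarrow>xs. (2 * l) powr s) \<le> M)"

lemma coverable_cball:
  assumes "0 < l" "2 * l \<le> \<delta>" "E \<subseteq> cball c l" "(2 * l) powr s \<le> M"
  shows "coverable s \<delta> M E"
  unfolding coverable_def using assms by (intro exI[of _ "[(c, l)]"]) auto

lemma coverable_mono:
  assumes "coverable s \<delta> M E" "F \<subseteq> E" "M \<le> M'"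
  shows "coverable s \<delta> M' F"
  using assms unfolding coverable_def by (meson order.trans)

lemma coverable_empty: "0 \<le> M \<Longrightarrow> coverable s \<delta> M {}"
  unfolding coverable_def by (intro exI[of _ "[]"]) auto

lemma coverable_Un:
  assumes "coverable s \<delta> M E" "coverable s \<delta> N F"
  shows "coverable s \<delta> (M + N) (E \<union> F)"
proof -
  obtain xs where xs: "\<forall>(c, l) \<in> set xs. 0 < l \<and> 2 * l \<le> \<delta>"
    "E \<subseteq> (\<Union>(c, l) \<in> set xs. cball c l)" "(\<Sum>(c, l)\<leftarrow>xs. (2 * l) powr s) \<le> M"
    using assms(1) unfolding coverable_def by blast
  obtain ys where ys: "\<forall>(c, l) \<in> set ys. 0 < l \<and> 2 * l \<le> \<delta>"
    "F \<subseteq> (\<Union>(c, l) \<in> set ys. cball c l)" "(\<Sum>(c, l)\<leftarrow>ys. (2 * l) powr s) \<le> N"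
    using assms(2) unfolding coverable_def by blast
  show ?thesis
    unfolding coverable_def
  proof (intro exI[of _ "xs @ ys"] conjI)
    show "\<forall>(c, l) \<in> set (xs @ ys). 0 < l \<and> 2 * l \<le> \<delta>" using xs(1) ys(1) by auto
    show "E \<union> F \<subseteq> (\<Union>(c, l) \<in> set (xs @ ys). cball c l)" using xs(2) ys(2) by auto
    show "(\<Sum>(c, l)\<leftarrow>xs @ ys. (2 * l) powr s) \<le> M + N" using xs(3) ys(3) by auto
  qed
qed

lemma coverable_UN:
  assumes "finite I" "\<And>i. i \<in> I \<Longrightarrow> coverable s \<delta> (M i) (E i)"
  shows "coverable s \<delta> (\<Sum>i\<in>I. M i) (\<Union>i\<in>I. E i)"
  using assms by (induction rule: finite_induct) (auto intro: coverable_empty coverable_Un)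

lemma hausdorff_premeasure_image_le:
  fixes f :: "real \<Rightarrow> 'a::metric_space"
  assumes cov: "coverable s \<delta> M E" and s: "0 \<le> s" and \<delta>: "0 < \<delta>"
    and lip: "\<And>x y. dist (f x) (f y) \<le> dist x y"
  shows "hausdorff_premeasure s \<delta> (f ` E) \<le> ennreal M"
proof -
  obtain xs where xs: "\<forall>(c, l) \<in> set xs. 0 < l \<and> 2 * l \<le> \<delta>"
    "E \<subseteq> (\<Union>(c, l) \<in> set xs. cball c l)" "(\<Sum>(c, l)\<leftarrow>xs. (2 * l) powr s) \<le> M"
    using cov unfolding coverable_def by blast
  define U where "U n = (if n < length xs then f ` cball (fst (xs ! n)) (snd (xs ! n)) else {})" for n
  have l: "0 < snd (xs ! n)" "2 * snd (xs ! n) \<le> \<delta>" if "n < length xs" for n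
    using xs(1) nth_mem[OF that] by auto
  have dist_le: "dist u v \<le> 2 * snd (xs ! n)" if uv: "n < length xs" "u \<in> U n" "v \<in> U n" for n u v
  proof -
    obtain x y where xy: "u = f x" "v = f y" "x \<in> cball (fst (xs ! n)) (snd (xs ! n))"
      "y \<in> cball (fst (xs ! n)) (snd (xs ! n))"
      using uv unfolding U_def by auto
    have "dist x y \<le> 2 * snd (xs ! n)"
      using xy(3,4) dist_triangle2[of x y "fst (xs ! n)"] by (simp add: dist_commute)
    then show ?thesis using lip[of x y] xy by simp
  qed
  have bd: "bounded (U n)" for n
  proof (cases "n < length xs")
    case True
    show ?thesis
      unfolding bounded_two_points using dist_le[OF True] by blast
  qed (simp add: U_def)
  have diam: "diameter (U n) \<le> 2 * snd (xs ! n)" if "n < length xs" for n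
    using dist_le[OF that] l(1)[OF that] unfolding diameter_def by (auto intro!: cSUP_least)
  have "U \<in> delta_covers \<delta> (f ` E)"
    unfolding delta_covers_def
  proof (intro CollectI conjI allI bd)
    show "diameter (U n) \<le> \<delta>" for n
    proof (cases "n < length xs")
      case True then show ?thesis using diam l by force
    qed (use \<delta> in \<open>simp add: U_def\<close>)
    show "f ` E \<subseteq> (\<Union>n. U n)"
    proof
      fix z assume "z \<in> f ` E"
      then obtain x where x: "x \<in> E" "z = f x" by blast
      then obtain p where p: "p \<in> set xs" "x \<in> cball (fst p) (snd p)" using xs(2) by force
      then obtain n where "n < length xs" "p = xs ! n" by (metis in_set_conv_nth)
      then show "z \<in> (\<Union>n. U n)" using x p by (auto simp: U_def)
    qed
  qed
  then have "hausdorff_premeasure s \<delta> (f ` E) \<le> (\<Sum>n. diam_pow s (U n))"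
    unfolding hausdorff_premeasure_def by (rule INF_lower)
  also have "\<dots> = (\<Sum>n<length xs. diam_pow s (U n))"
    by (rule suminf_finite) (auto simp: U_def diam_pow_def)
  also have "\<dots> \<le> (\<Sum>n<length xs. ennreal ((2 * snd (xs ! n)) powr s))"
  proof (rule sum_mono)
    fix n assume "n \<in> {..<length xs}"
    then have n: "n < length xs" by simp
    have "0 \<le> diameter (U n)" using bd by (rule diameter_ge_0)
    then show "diam_pow s (U n) \<le> ennreal ((2 * snd (xs ! n)) powr s)"
      using diam[OF n] l[OF n] s by (auto simp: diam_pow_def intro!: ennreal_leI powr_mono2)
  qed
  also have "\<dots> = ennreal (\<Sum>n<length xs. (2 * snd (xs ! n)) powr s)"
    by (rule sum_ennreal) auto
  also have "(\<Sum>n<length xs. (2 * snd (xs ! n)) powr s) = (\<Sum>(c, l)\<leftarrow>xs. (2 * l) powr s)"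
    by (simp add: sum_list_sum_nth atLeast0LessThan case_prod_beta)
  also have "ennreal \<dots> \<le> ennreal M" using xs(3) by (rule ennreal_leI)
  finally show ?thesis .
qed

section \<open>Numbers close to one\<close>

lemma integer_combination_near_zero:
  fixes x b e :: real
  assumes "0 \<le> x" "0 < b" "0 < e"
  obtains m n :: nat where "1 \<le> m" "\<bar>real m * x - real n * b\<bar> < e"
proof -
  obtain N :: nat where N: "b / e < N" using reals_Archimedean2 by blast
  then have N0: "0 < N" using assms by (metis divide_pos_pos gr0I less_asym of_nat_0)
  obtain h k where hk: "0 < k" "k \<le> int N" "\<bar>of_int k * (x / b) - of_int h\<bar> < 1 / N"
    using Dirichlet_approx[OF N0] by blast
  have "0 \<le> h"
  proof (rule ccontr)
    assume "\<not> 0 \<le> h"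
    then have "of_int h \<le> (-1 :: real)" by linarith
    moreover have "0 \<le> of_int k * (x / b)" using assms hk by simp
    moreover have "1 / real N \<le> 1" using N0 by simp
    ultimately show False using hk(3) by linarith
  qed
  have "\<bar>of_int k * x - of_int h * b\<bar> = b * \<bar>of_int k * (x / b) - of_int h\<bar>"
    using assms by (simp add: abs_mult_pos[symmetric] field_simps)
  also have "\<dots> < b * (1 / N)" using hk(3) assms(2) by (intro mult_strict_left_mono) auto
  also have "\<dots> \<le> e" using N N0 assms by (simp add: field_simps)
  finally have "\<bar>real (nat k) * x - real (nat h) * b\<bar> < e"
    using hk \<open>0 \<le> h\<close> by simp
  then show ?thesis using hk by (intro that[of "nat k" "nat h"]) auto
qed

text \<open>Multiplicative form.\<close>
text \<open>
  The multiplicative form of the previous lemma.  Even powers are used so that the product is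
  positive whatever the signs of \<open>z\<close> and \<open>q\<close>.
\<close>
lemma power_product_near_one:
  fixes z q \<eta> :: real
  assumes "1 \<le> \<bar>z\<bar>" "0 < \<bar>q\<bar>" "\<bar>q\<bar> < 1" "0 < \<eta>"
  obtains m n :: nat where "\<bar>z * z ^ (2 * m + 1) * q ^ (2 * n) - 1\<bar> < \<eta>"
proof -
  have "isCont exp (0::real)" by simp
  then obtain e where e: "0 < e" "\<And>y::real. \<bar>y\<bar> < e \<Longrightarrow> \<bar>exp y - 1\<bar> < \<eta>"
    using \<open>0 < \<eta>\<close> unfolding continuous_at_eps_delta by (auto simp: dist_real_def)
  obtain m n :: nat where mn: "1 \<le> m" "\<bar>real m * (2 * ln \<bar>z\<bar>) - real n * (- 2 * ln \<bar>q\<bar>)\<bar> < e"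
    using integer_combination_near_zero[of "2 * ln \<bar>z\<bar>" "- 2 * ln \<bar>q\<bar>" e] assms e by auto
  have "exp (real m * (2 * ln \<bar>z\<bar>) - real n * (- 2 * ln \<bar>q\<bar>))
      = exp (real (2 * m) * ln \<bar>z\<bar>) * exp (real (2 * n) * ln \<bar>q\<bar>)"
    by (simp add: exp_add[symmetric] algebra_simps)
  also have "\<dots> = \<bar>z\<bar> ^ (2 * m) * \<bar>q\<bar> ^ (2 * n)"
    using assms by (simp only: exp_of_nat_mult) simp
  also have "\<dots> = z ^ (2 * m) * q ^ (2 * n)" by (simp add: power_even_abs)
  also have "z ^ (2 * m) = z * z ^ (2 * (m - 1) + 1)"
    using mn(1) by (metis Suc_eq_plus1 Suc_pred' add_Suc_right mult_Suc_right power_Suc less_eq_Suc_le One_nat_def add_2_eq_Suc)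
  finally show ?thesis using that e(2)[OF mn(2)] by metis
qed

lemma ratio_close:
  fixes p q a :: real
  assumes "\<bar>p - q\<bar> < e * a" "a \<le> \<bar>q\<bar>" "0 < a" "0 < e"
  shows "\<bar>p / q - 1\<bar> < e"
proof -
  have "q \<noteq> 0" using assms by auto
  then have "p / q - 1 = (p - q) / q" by (simp add: diff_divide_distrib)
  moreover have "\<bar>p - q\<bar> < e * \<bar>q\<bar>" using assms by (smt (verit) mult_left_mono)
  ultimately show ?thesis using \<open>q \<noteq> 0\<close> by (simp add: abs_divide pos_divide_less_eq)
qed

lemma product_close:
  fixes a b e :: real
  assumes "\<bar>a - 1\<bar> < e" "\<bar>b - 1\<bar> < f" "e \<le> 1"
  shows "\<bar>a * b - 1\<bar> < e + 2 * f"
proof -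
  have "a * b - 1 = (a - 1) + a * (b - 1)" by (simp add: algebra_simps)
  then have "\<bar>a * b - 1\<bar> \<le> \<bar>a - 1\<bar> + \<bar>a\<bar> * \<bar>b - 1\<bar>" by (metis abs_mult abs_triangle_ineq)
  moreover have "\<bar>a\<bar> * \<bar>b - 1\<bar> \<le> 2 * \<bar>b - 1\<bar>" using assms by (intro mult_right_mono) auto
  ultimately show ?thesis using assms by linarith
qed

lemma inverse_close:
  fixes a e :: real
  assumes "\<bar>a - 1\<bar> < e" "e \<le> 1/2"
  shows "\<bar>1 / a - 1\<bar> < 2 * e"
proof -
  have a: "1/2 < a" using assms by linarith
  then have "1 / a - 1 = (1 - a) / a" by (simp add: diff_divide_distrib)
  then have "\<bar>1 / a - 1\<bar> = \<bar>1 - a\<bar> / a" using a by (simp add: abs_divide)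
  also have "\<dots> < 2 * e"
  proof -
    have "e * 1 \<le> e * (2 * a)" using a assms by (intro mult_left_mono) linarith+
    then have "\<bar>1 - a\<bar> < 2 * e * a" using assms by linarith
    then show ?thesis using a by (simp add: pos_divide_less_eq)
  qed
  finally show ?thesis .
qed

section \<open>Affine iterated function systems on the line\<close>

text \<open>
  One affine iterated function system with its attractor \<open>C\<close> and similarity dimension \<open>d\<close>.
\<close>
locale affine_ifs =
  fixes A :: nat and sg r b :: "nat \<Rightarrow> real" and d :: real and C :: "real set"
  assumes ifs: "affine_cantor_set A sg r b d C"
begin

text \<open>
  A word is a list of indices in \<open>{1..A}\<close>; the word \<open>[i, j, ...]\<close> stands for the composition
  \<open>F i \<circ> F j \<circ> ...\<close>, which is the affine map \<open>act v\<close> with signed ratio \<open>slope v\<close>.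
  The weights \<open>\<bar>slope v\<bar> ^ d\<close> of the words of any fixed length add up to 1.
\<close>
definition slope :: "nat list \<Rightarrow> real" where
  "slope v = prod_list (map (\<lambda>i. sg i * r i) v)"

definition act :: "nat list \<Rightarrow> real \<Rightarrow> real" where
  "act v = foldr (\<lambda>i x. sg i * r i * x + b i) v"

definition words :: "nat \<Rightarrow> nat list set" where
  "words n = {v. set v \<subseteq> {1..A} \<and> length v = n}"

definition weight :: "nat list \<Rightarrow> real" where
  "weight v = \<bar>slope v\<bar> powr d"

text \<open>
  The least and the greatest contraction ratio of the system.
\<close>
definition lo :: real where "lo = Min (r ` {1..A})"
definition hi :: real where "hi = Max (r ` {1..A})"

lemma ratio: "i \<in> {1..A} \<Longrightarrow> \<bar>sg i * r i\<bar> = r i" "i \<in> {1..A} \<Longrightarrow> 0 < r i" "i \<in> {1..A} \<Longrightarrow> r i < 1"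
proof -
  have *: "(sg i = 1 \<or> sg i = -1) \<and> 0 < r i \<and> r i < 1" if "i \<in> {1..A}"
    using ifs that unfolding affine_cantor_set_def by blast
  show "i \<in> {1..A} \<Longrightarrow> \<bar>sg i * r i\<bar> = r i" "i \<in> {1..A} \<Longrightarrow> 0 < r i" "i \<in> {1..A} \<Longrightarrow> r i < 1"
    using * by fastforce+
qed

lemma sum_ratio: "(\<Sum>i=1..A. r i powr d) = 1"
  using ifs by (auto simp: affine_cantor_set_def)

lemma A_pos: "1 \<le> A"
  using sum_ratio by (cases "A = 0") auto

lemma attractor: "compact C" "C \<noteq> {}" "C = (\<Union>i\<in>{1..A}. (\<lambda>x. sg i * r i * x + b i) ` C)"
  using ifs by (auto simp: affine_cantor_set_def is_attractor_def)

lemma dim_nonneg: "0 \<le> d"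
proof (rule ccontr)
  assume "\<not> 0 \<le> d"
  have 1: "1 \<in> {1..A}" using A_pos by simp
  have "1 < r 1 powr d"
    using ratio(2,3)[OF 1] \<open>\<not> 0 \<le> d\<close> powr_less_mono2_neg[of d "r 1" 1] by simp
  also have "\<dots> \<le> (\<Sum>i=1..A. r i powr d)"
    using 1 by (intro member_le_sum) auto
  finally show False using sum_ratio by simp
qed

lemma lo_hi: "0 < lo" "hi < 1" "i \<in> {1..A} \<Longrightarrow> lo \<le> r i" "i \<in> {1..A} \<Longrightarrow> r i \<le> hi" "0 < hi" "lo < 1"
proof -
  have ne: "r ` {1..A} \<noteq> {}" using A_pos by auto
  show "0 < lo" "hi < 1" unfolding lo_def hi_def using ne ratio by (auto simp: Min_gr_iff Max_less_iff)
  show *: "i \<in> {1..A} \<Longrightarrow> lo \<le> r i" "i \<in> {1..A} \<Longrightarrow> r i \<le> hi" for i unfolding lo_def hi_def by auto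
  have 1: "1 \<in> {1..A}" using A_pos by simp
  show "0 < hi" "lo < 1" using *[OF 1] ratio(2,3)[OF 1] by linarith+
qed

lemma finite_words: "finite (words n)"
  unfolding words_def by (rule finite_lists_length_eq) simp

lemma words_0: "words 0 = {[]}" by (auto simp: words_def)

lemma words_Suc: "words (Suc n) = (\<lambda>(i, v). i # v) ` ({1..A} \<times> words n)"
  by (auto simp: words_def length_Suc_conv image_iff)

lemma slope_Nil [simp]: "slope [] = 1" by (simp add: slope_def)
lemma slope_Cons [simp]: "slope (i # v) = sg i * r i * slope v" by (simp add: slope_def)
lemma slope_append [simp]: "slope (u @ v) = slope u * slope v" by (simp add: slope_def)

lemma act_append: "act (u @ v) x = act u (act v x)" by (simp add: act_def)

lemma act_affine: "act v x = slope v * x + act v 0"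
  by (induction v) (auto simp: act_def algebra_simps)

lemma weight_append [simp]: "weight (u @ v) = weight u * weight v"
  by (simp add: weight_def abs_mult powr_mult)

lemma weight_Nil [simp]: "weight [] = 1" by (simp add: weight_def)

lemma slope_bounds:
  assumes "set v \<subseteq> {1..A}"
  shows "lo ^ length v \<le> \<bar>slope v\<bar>" "\<bar>slope v\<bar> \<le> hi ^ length v"
proof -
  have "lo ^ length v \<le> \<bar>slope v\<bar> \<and> \<bar>slope v\<bar> \<le> hi ^ length v"
    using assms
  proof (induction v)
    case (Cons i v)
    then have i: "i \<in> {1..A}" and IH: "lo ^ length v \<le> \<bar>slope v\<bar>" "\<bar>slope v\<bar> \<le> hi ^ length v" by auto
    have "\<bar>slope (i # v)\<bar> = r i * \<bar>slope v\<bar>" using ratio(1)[OF i] by (simp add: abs_mult)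
    then show ?case
      using IH lo_hi(1,5) lo_hi(3,4)[OF i] ratio(2)[OF i] by (auto intro!: mult_mono)
  qed simp
  then show "lo ^ length v \<le> \<bar>slope v\<bar>" "\<bar>slope v\<bar> \<le> hi ^ length v" by auto
qed

lemma slope_pos: "set v \<subseteq> {1..A} \<Longrightarrow> 0 < \<bar>slope v\<bar>"
  using slope_bounds(1)[of v] lo_hi(1) by (meson less_le_trans zero_less_power)

lemma slope_nonzero: "set v \<subseteq> {1..A} \<Longrightarrow> slope v \<noteq> 0"
  using slope_pos by fastforce

lemma slope_le_1: "set v \<subseteq> {1..A} \<Longrightarrow> \<bar>slope v\<bar> \<le> 1"
  using slope_bounds(2)[of v] lo_hi(2,5) power_le_one[of hi "length v"] by linarith

lemma weight_pos: "set v \<subseteq> {1..A} \<Longrightarrow> 0 < weight v"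
  unfolding weight_def using slope_nonzero by simp

lemma weight_nonneg: "0 \<le> weight v"
  unfolding weight_def by simp

lemma sum_weight: "(\<Sum>v\<in>words n. weight v) = 1"
proof (induction n)
  case (Suc n)
  have "(\<Sum>v\<in>words (Suc n). weight v) = (\<Sum>(i, v)\<in>{1..A} \<times> words n. weight (i # v))"
    unfolding words_Suc by (subst sum.reindex) (auto simp: inj_on_def case_prod_beta)
  also have "\<dots> = (\<Sum>(i, v)\<in>{1..A} \<times> words n. r i powr d * weight v)"
  proof (rule sum.cong)
    fix p assume "p \<in> {1..A} \<times> words n"
    then obtain i v where p: "p = (i, v)" "i \<in> {1..A}" by auto
    show "(case p of (i, v) \<Rightarrow> weight (i # v)) = (case p of (i, v) \<Rightarrow> r i powr d * weight v)"
      using p ratio[OF p(2)] by (simp add: weight_def abs_mult powr_mult)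
  qed simp
  also have "\<dots> = (\<Sum>i=1..A. r i powr d) * (\<Sum>v\<in>words n. weight v)"
    by (simp add: sum_product sum.cartesian_product)
  finally show ?case using Suc sum_ratio by simp
qed (simp add: words_0)

lemma act_in: "set v \<subseteq> {1..A} \<Longrightarrow> x \<in> C \<Longrightarrow> act v x \<in> C"
proof (induction v)
  case (Cons i v)
  then have "act (i # v) x = sg i * r i * act v x + b i" "act v x \<in> C" "i \<in> {1..A}"
    by (auto simp: act_def)
  then show ?case by (subst attractor(3)) blast
qed (simp add: act_def)

lemma attractor_words: "C = (\<Union>v\<in>words n. act v ` C)"
proof (induction n)
  case (Suc n)
  have "C \<subseteq> (\<Union>v\<in>words (Suc n). act v ` C)"
  proof
    fix x assume "x \<in> C"
    then obtain i y where i: "i \<in> {1..A}" "y \<in> C" "x = sg i * r i * y + b i"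
      using attractor(3) by blast
    then obtain v z where "v \<in> words n" "z \<in> C" "y = act v z" using Suc by blast
    then have "i # v \<in> words (Suc n)" "x = act (i # v) z" "z \<in> C"
      using i by (auto simp: words_Suc act_def)
    then show "x \<in> (\<Union>v\<in>words (Suc n). act v ` C)" by blast
  qed
  then show ?case using act_in by (auto simp: words_def)
qed (simp add: words_0 act_def)

text \<open>
  Every point of the attractor has an address: an infinite word \<open>a\<close> such that the point lies in the
  image of the attractor under each finite prefix of \<open>a\<close>.
\<close>
lemma address_exists:
  assumes "x \<in> C"
  obtains a z where "\<And>n. a n \<in> {1..A}" "\<And>n. z n \<in> C" "\<And>n. x = act (map a [0..<n]) (z n)"
proof -
  have "\<forall>y\<in>C. \<exists>i z. i \<in> {1..A} \<and> z \<in> C \<and> y = sg i * r i * z + b i"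
    using attractor(3) by blast
  then obtain I Z where IZ: "\<And>y. y \<in> C \<Longrightarrow> I y \<in> {1..A} \<and> Z y \<in> C \<and> y = sg (I y) * r (I y) * Z y + b (I y)"
    by metis
  define z where "z n = (Z ^^ n) x" for n
  have z: "z n \<in> C" for n
    by (induction n) (use assms IZ in \<open>auto simp: z_def\<close>)
  have x: "x = act (map (\<lambda>n. I (z n)) [0..<n]) (z n)" for n
  proof (induction n)
    case (Suc n)
    have "z n = sg (I (z n)) * r (I (z n)) * z (Suc n) + b (I (z n))"
      using IZ[OF z[of n]] by (simp add: z_def)
    with Suc show ?case by (simp add: act_def)
  qed (simp add: act_def z_def)
  have "I (z n) \<in> {1..A}" for n using IZ[OF z] by blast
  from that[of "\<lambda>n. I (z n)" z, OF this z x] show ?thesis .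
qed

text \<open>
  Along an address the ratio tends to 0 and is multiplied by at least \<open>lo\<close> in each step, so some prefix meets
  the scale \<open>\<rho>\<close> up to that factor.
\<close>
lemma stopping_exists:
  assumes a: "\<And>n. a n \<in> {1..A}" and \<rho>: "0 < \<rho>" "\<rho> \<le> 1"
  obtains n where "\<bar>slope (map a [0..<n])\<bar> \<le> \<rho>" "lo * \<rho> \<le> \<bar>slope (map a [0..<n])\<bar>"
proof -
  have w: "set (map a [0..<n]) \<subseteq> {1..A}" for n using a by auto
  obtain N where N: "hi ^ N < \<rho>" using real_arch_pow_inv[OF \<rho>(1) lo_hi(2)] by blast
  define n where "n = (LEAST n. \<bar>slope (map a [0..<n])\<bar> \<le> \<rho>)"
  have ex: "\<bar>slope (map a [0..<N])\<bar> \<le> \<rho>" using slope_bounds(2)[OF w[of N]] N by simp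
  have n: "\<bar>slope (map a [0..<n])\<bar> \<le> \<rho>" unfolding n_def using ex by (rule LeastI)
  have "lo * \<rho> \<le> \<bar>slope (map a [0..<n])\<bar>"
  proof (cases n)
    case 0
    then show ?thesis using \<rho> lo_hi(1,6) mult_mono[of lo 1 \<rho> 1] by simp
  next
    case (Suc m)
    then have "\<rho> < \<bar>slope (map a [0..<m])\<bar>"
      using not_less_Least[of m "\<lambda>n. \<bar>slope (map a [0..<n])\<bar> \<le> \<rho>"] unfolding n_def[symmetric] by auto
    moreover have "\<bar>slope (map a [0..<n])\<bar> = r (a m) * \<bar>slope (map a [0..<m])\<bar>"
      using Suc ratio(1)[OF a[of m]] by (simp add: abs_mult)
    ultimately show ?thesis
      using lo_hi(1) lo_hi(3)[OF a[of m]] \<rho> by (auto intro!: mult_mono)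
  qed
  with n show ?thesis by (rule that)
qed

lemma words_append: "u \<in> words m \<Longrightarrow> v \<in> words n \<Longrightarrow> u @ v \<in> words (m + n)"
  by (auto simp: words_def)

lemma bound_exists: obtains L where "0 < L" "\<And>x. x \<in> C \<Longrightarrow> \<bar>x\<bar> \<le> L"
proof -
  obtain L where "0 < L" "\<And>x. x \<in> C \<Longrightarrow> norm x \<le> L"
    using compact_imp_bounded[OF attractor(1)] by (metis bounded_pos)
  then show ?thesis using that by simp
qed

text \<open>
  The translation part \<open>act v 0\<close> serves as the reference point of the cylinder of \<open>v\<close>; as 0 need not belong
  to \<open>C\<close>, it is only near that cylinder.
\<close>
lemma act_prefix_bound:
  assumes "x = act v z" "z \<in> C" "\<And>x. x \<in> C \<Longrightarrow> \<bar>x\<bar> \<le> L" "\<bar>slope v\<bar> \<le> \<rho>"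
  shows "\<bar>act (v @ p) 0 - x\<bar> \<le> (\<bar>act p 0\<bar> + L) * \<rho>"
proof -
  have "act (v @ p) 0 - x = slope v * (act p 0 - z)"
    unfolding act_append assms(1) using act_affine[of v "act p 0"] act_affine[of v z] by (simp add: algebra_simps)
  then have "\<bar>act (v @ p) 0 - x\<bar> = \<bar>act p 0 - z\<bar> * \<bar>slope v\<bar>" by (simp add: abs_mult)
  also have "\<dots> \<le> (\<bar>act p 0\<bar> + L) * \<rho>"
    using assms(3)[OF assms(2)] assms(4) by (intro mult_mono) auto
  finally show ?thesis .
qed

lemma addresses_differ:
  assumes "\<And>n. a n \<in> {1..A}" "\<And>n. z n \<in> C" "\<And>n. x = act (map a [0..<n]) (z n)"
    and "\<And>n. z' n \<in> C" "\<And>n. x' = act (map a' [0..<n]) (z' n)" "x \<noteq> x'"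
  obtains k where "map a [0..<k] \<noteq> map a' [0..<k]"
proof (rule ccontr)
  assume "\<not> thesis"
  then have eq: "map a [0..<k] = map a' [0..<k]" for k using that by blast
  obtain L where L: "0 < L" "\<And>x. x \<in> C \<Longrightarrow> \<bar>x\<bar> \<le> L" using bound_exists by blast
  have "0 < \<bar>x - x'\<bar> / (2 * L)" using assms(6) L by simp
  then obtain n where n: "hi ^ n < \<bar>x - x'\<bar> / (2 * L)" using real_arch_pow_inv[OF _ lo_hi(2)] by blast
  define v where "v = map a [0..<n]"
  have "set v \<subseteq> {1..A}" using assms(1) unfolding v_def by auto
  then have v: "\<bar>slope v\<bar> \<le> hi ^ n" using slope_bounds(2)[of v] unfolding v_def by simp
  have "x = act v (z n)" unfolding v_def by (rule assms(3))
  moreover have "x' = act v (z' n)" unfolding v_def eq[of n] by (rule assms(5))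
  ultimately have "x - x' = slope v * (z n - z' n)"
    using act_affine[of v "z n"] act_affine[of v "z' n"] by (simp add: algebra_simps)
  then have "\<bar>x - x'\<bar> = \<bar>slope v\<bar> * \<bar>z n - z' n\<bar>" by (simp add: abs_mult)
  also have "\<dots> \<le> hi ^ n * (2 * L)"
    using v L(2)[OF assms(2)[of n]] L(2)[OF assms(4)[of n]] lo_hi(5) by (intro mult_mono) auto
  also have "\<dots> < \<bar>x - x'\<bar>" using n L(1) by (simp add: field_simps)
  finally show False by simp
qed

text \<open>Prefixes of the address of a point, with slope comparable to \<open>1 / 2 ^ N\<close>.\<close>
lemma prefixes_exist:
  assumes "\<And>n. a n \<in> {1..A}"
  obtains h where "\<And>N. \<bar>slope (map a [0..<h N])\<bar> \<le> (1/2) ^ N" "\<And>N. lo * (1/2) ^ N \<le> \<bar>slope (map a [0..<h N])\<bar>"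
proof -
  have "\<exists>n. \<bar>slope (map a [0..<n])\<bar> \<le> (1/2) ^ N \<and> lo * (1/2) ^ N \<le> \<bar>slope (map a [0..<n])\<bar>" for N :: nat
  proof -
    have "0 < (1/2 :: real) ^ N" "(1/2 :: real) ^ N \<le> 1" by (auto intro: power_le_one)
    from stopping_exists[of a, OF assms this] show ?thesis by metis
  qed
  then show ?thesis using that by metis
qed

end

section \<open>Pairs of systems, cells and clusters\<close>

text \<open>
  The two systems.  Pairs \<open>(u, w)\<close> of words, one in each alphabet, play the role of the cylinders of the
  product \<open>C1 \<times> C2\<close>.  The two words may have different lengths.
\<close>
locale affine_ifs_pair =
  X: affine_ifs A sg1 r1 b1 d1 C1 + Y: affine_ifs B sg2 r2 b2 d2 C2
  for A :: nat and sg1 r1 b1 :: "nat \<Rightarrow> real" and d1 :: real and C1 :: "real set"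
    and B :: nat and sg2 r2 b2 :: "nat \<Rightarrow> real" and d2 :: real and C2 :: "real set"
begin

abbreviation wordX :: "nat list \<Rightarrow> bool" where "wordX u \<equiv> set u \<subseteq> {1..A}"
abbreviation wordY :: "nat list \<Rightarrow> bool" where "wordY w \<equiv> set w \<subseteq> {1..B}"

text \<open>
  For an angle with tangent \<open>t\<close> the projection of \<open>(x, y)\<close> is, up to a factor, \<open>x + t * y\<close>.  The set
  \<open>cell t u w\<close> is the projection of the cylinder \<open>(u, w)\<close>; in particular \<open>cell t [] []\<close> is the
  projection of the whole product.
\<close>
definition proj :: "real \<Rightarrow> nat list \<Rightarrow> nat list \<Rightarrow> real \<Rightarrow> real \<Rightarrow> real" where
  "proj t u w x y = X.act u x + t * Y.act w y"

definition cell :: "real \<Rightarrow> nat list \<Rightarrow> nat list \<Rightarrow> real set" where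
  "cell t u w = {proj t u w x y | x y. x \<in> C1 \<and> y \<in> C2}"

text \<open>
  The total weight of a family of pairs of words.
\<close>
definition mass :: "(nat list \<times> nat list) set \<Rightarrow> real" where
  "mass Q = (\<Sum>(u, w)\<in>Q. X.weight u * Y.weight w)"

text \<open>
  The parameter \<open>t\<close> is \<open>\<epsilon>\<close>-clustered if some cells, all coming from words of the same lengths, lie in one
  interval whose cost in the dimension \<open>d1 + d2\<close> is less than \<open>\<epsilon>\<close> times their total weight.  Fixing the
  lengths makes the cylinders of distinct pairs disjoint in the space of addresses, so that no weight is
  counted twice.
\<close>
definition clustered :: "real \<Rightarrow> real \<Rightarrow> bool" where
  "clustered \<epsilon> t \<longleftrightarrow> (\<exists>m n Q c l. Q \<subseteq> X.words m \<times> Y.words n \<and> 0 < l \<and>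
     (\<forall>(u, w)\<in>Q. cell t u w \<subseteq> cball c l) \<and> (2 * l) powr (d1 + d2) < \<epsilon> * mass Q)"

lemma slope_replicate:
  "X.slope (concat (replicate k u)) = X.slope u ^ k" "Y.slope (concat (replicate k u)) = Y.slope u ^ k"
  by (induction k) auto

lemma return_words_aux:
  assumes u: "wordX u" and w: "wordY w" and e: "0 < \<eta>"
  shows "1 \<le> \<bar>Y.slope w / X.slope u\<bar> \<Longrightarrow> \<exists>a c. wordX a \<and> wordY c \<and> \<bar>Y.slope (w @ c) / X.slope (u @ a) - 1\<bar> < \<eta>"
    and "1 \<le> \<bar>X.slope u / Y.slope w\<bar> \<Longrightarrow> \<exists>a c. wordX a \<and> wordY c \<and> \<bar>X.slope (u @ a) / Y.slope (w @ c) - 1\<bar> < \<eta>"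
proof -
  have p: "0 < \<bar>X.slope [1]\<bar>" "\<bar>X.slope [1]\<bar> < 1" "0 < \<bar>Y.slope [1]\<bar>" "\<bar>Y.slope [1]\<bar> < 1"
    using X.slope_bounds[of "[1]"] Y.slope_bounds[of "[1]"] X.A_pos Y.A_pos X.lo_hi(1,2) Y.lo_hi(1,2) by auto
  have nz: "X.slope u \<noteq> 0" "Y.slope w \<noteq> 0" using X.slope_nonzero[OF u] Y.slope_nonzero[OF w] .
  have wr: "wordX (concat (replicate k u))" "wordY (concat (replicate k w))"
    "wordX (concat (replicate k [1]))" "wordY (concat (replicate k [1]))" for k
    using u w X.A_pos Y.A_pos by auto
  show "\<exists>a c. wordX a \<and> wordY c \<and> \<bar>Y.slope (w @ c) / X.slope (u @ a) - 1\<bar> < \<eta>"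
    if z: "1 \<le> \<bar>Y.slope w / X.slope u\<bar>"
  proof -
    obtain m n where mn: "\<bar>Y.slope w / X.slope u * (Y.slope w / X.slope u) ^ (2 * m + 1) * Y.slope [1] ^ (2 * n) - 1\<bar> < \<eta>"
      using power_product_near_one[OF z p(3,4) e] by blast
    define a where "a = concat (replicate (2 * m + 1) u)"
    define c where "c = concat (replicate (2 * m + 1) w) @ concat (replicate (2 * n) [1])"
    have "wordX a" "wordY c" using wr unfolding a_def c_def set_append by blast+
    moreover have eq: "Y.slope (w @ c) / X.slope (u @ a)
        = Y.slope w / X.slope u * (Y.slope w / X.slope u) ^ (2 * m + 1) * Y.slope [1] ^ (2 * n)"
      unfolding a_def c_def X.slope_append Y.slope_append slope_replicate power_divide by simp
    ultimately show ?thesis using mn[folded eq] by blast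
  qed
  show "\<exists>a c. wordX a \<and> wordY c \<and> \<bar>X.slope (u @ a) / Y.slope (w @ c) - 1\<bar> < \<eta>"
    if z: "1 \<le> \<bar>X.slope u / Y.slope w\<bar>"
  proof -
    obtain m n where mn: "\<bar>X.slope u / Y.slope w * (X.slope u / Y.slope w) ^ (2 * m + 1) * X.slope [1] ^ (2 * n) - 1\<bar> < \<eta>"
      using power_product_near_one[OF z p(1,2) e] by blast
    define c where "c = concat (replicate (2 * m + 1) w)"
    define a where "a = concat (replicate (2 * m + 1) u) @ concat (replicate (2 * n) [1])"
    have "wordX a" "wordY c" using wr unfolding a_def c_def set_append by blast+
    moreover have eq: "X.slope (u @ a) / Y.slope (w @ c)
        = X.slope u / Y.slope w * (X.slope u / Y.slope w) ^ (2 * m + 1) * X.slope [1] ^ (2 * n)"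
      unfolding a_def c_def X.slope_append Y.slope_append slope_replicate power_divide by simp
    ultimately show ?thesis using mn[folded eq] by blast
  qed
qed

text \<open>
  Any pair of words can be prolonged so that the ratio of the two slopes becomes almost 1, sign included.
  The prolongation repeats both words and adds copies of a single letter to one of them.
\<close>
lemma return_words:
  assumes u: "wordX u" and w: "wordY w" and e: "0 < \<eta>"
  obtains a c where "wordX a" "wordY c" "\<bar>Y.slope (w @ c) / X.slope (u @ a) - 1\<bar> < \<eta>"
proof (cases "1 \<le> \<bar>Y.slope w / X.slope u\<bar>")
  case True
  then show ?thesis using return_words_aux(1)[OF u w e] that by blast
next
  case False
  define e' where "e' = min (1/2) (\<eta> / 2)"
  have e': "0 < e'" "e' \<le> 1/2" "e' \<le> \<eta> / 2" using e unfolding e'_def by auto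
  have "1 \<le> \<bar>X.slope u / Y.slope w\<bar>"
    using False X.slope_pos[OF u] Y.slope_pos[OF w] by (simp add: divide_simps split: if_splits)
  then obtain a c where ac: "wordX a" "wordY c" "\<bar>X.slope (u @ a) / Y.slope (w @ c) - 1\<bar> < e'"
    using return_words_aux(2)[OF u w e'(1)] by blast
  define v where "v = X.slope (u @ a) / Y.slope (w @ c)"
  have v: "1/2 < v" "\<bar>1 - v\<bar> < \<eta> / 2" using ac(3) e' unfolding v_def[symmetric] by linarith+
  have "1 / v - 1 = (1 - v) / v" using v(1) by (simp add: diff_divide_distrib)
  then have "\<bar>1 / v - 1\<bar> = \<bar>1 - v\<bar> / v" using v(1) by (simp add: abs_divide)
  also have "\<dots> < \<eta>"
  proof -
    have "\<eta> * (1 / 2) < \<eta> * v" using v(1) e by (rule mult_strict_left_mono)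
    then have "\<bar>1 - v\<bar> < \<eta> * v" using v(2) by linarith
    then show ?thesis using v(1) by (simp add: pos_divide_less_eq)
  qed
  finally show ?thesis using that ac(1,2) unfolding v_def by simp
qed

text \<open>
  The rectangle belonging to \<open>(u, w)\<close> is a square up to the factor \<open>R\<close>.
\<close>
definition balanced :: "real \<Rightarrow> nat list \<Rightarrow> nat list \<Rightarrow> bool" where
  "balanced R u w \<longleftrightarrow> \<bar>X.slope u\<bar> \<le> R * \<bar>Y.slope w\<bar> \<and> \<bar>Y.slope w\<bar> \<le> R * \<bar>X.slope u\<bar>"

text \<open>
  By compactness finitely many prolongations serve all balanced pairs.
\<close>
lemma finitely_many_return_words:
  assumes "0 < \<eta>"
  obtains F where "finite F" "\<And>a c. (a, c) \<in> F \<Longrightarrow> wordX a \<and> wordY c"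
    "\<And>u w. wordX u \<Longrightarrow> wordY w \<Longrightarrow> balanced R u w \<Longrightarrow>
       \<exists>(a, c)\<in>F. \<bar>Y.slope (w @ c) / X.slope (u @ a) - 1\<bar> < \<eta>"
proof -
  \<comment> \<open>the closure of the set of slope ratios is covered by the open sets \<open>Op p\<close>\<close>
  define Z where "Z = {Y.slope w / X.slope u | u w. wordX u \<and> wordY w \<and> balanced R u w}"
  define P where "P = {(a, c). wordX a \<and> wordY c}"
  define Op where "Op p = {x. \<bar>x * (Y.slope (snd p) / X.slope (fst p)) - 1\<bar> < \<eta>}" for p
  have bounds: "\<bar>z\<bar> \<le> R \<and> 1 \<le> R * \<bar>z\<bar>" if "z \<in> Z" for z
  proof -
    obtain u w where uw: "z = Y.slope w / X.slope u" "wordX u" "wordY w" "balanced R u w"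
      using \<open>z \<in> Z\<close> unfolding Z_def by blast
    show ?thesis using uw(4) X.slope_pos[OF uw(2)] unfolding uw(1) balanced_def by (simp add: abs_divide field_simps)
  qed
  have "bounded Z" unfolding bounded_iff using bounds by auto
  then have "compact (closure Z)" by (simp add: compact_closure)
  moreover have "open (Op p)" if "p \<in> P" for p
    unfolding Op_def by (intro open_Collect_less continuous_intros)
  moreover have "closure Z \<subseteq> (\<Union>p\<in>P. Op p)"
  proof
    fix x assume x: "x \<in> closure Z"
    define \<tau> where "\<tau> = \<eta> / (2 * (1 + \<eta>))"
    have \<tau>: "0 < \<tau>" "\<tau> * (1 + \<eta>) = \<eta> / 2" using assms by (auto simp: \<tau>_def field_simps)
    have "Z \<noteq> {}" using x by auto
    then obtain z0 where "z0 \<in> Z" by blast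
    then have "0 < R" using bounds[of z0] by (smt (verit) mult_nonpos_nonneg)
    then obtain z where z: "z \<in> Z" "dist z x < \<tau> / R"
      using x \<tau> by (metis closure_approachable divide_pos_pos)
    then obtain u w where uw: "z = Y.slope w / X.slope u" "wordX u" "wordY w"
      unfolding Z_def by blast
    obtain a c where ac: "wordX a" "wordY c" "\<bar>Y.slope (w @ c) / X.slope (u @ a) - 1\<bar> < \<eta> / 2"
      using return_words[OF uw(2,3), of "\<eta> / 2"] assms by auto
    define k where "k = Y.slope c / X.slope a"
    have zk: "\<bar>z * k - 1\<bar> < \<eta> / 2" using ac(3) unfolding uw(1) k_def by simp
    have "\<bar>x - z\<bar> \<le> \<tau> * \<bar>z\<bar>"
    proof -
      have "\<tau> / R \<le> \<tau> * \<bar>z\<bar>" using bounds[OF z(1)] \<open>0 < R\<close> \<tau> by (simp add: field_simps)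
      then show ?thesis using z(2) by (simp add: dist_real_def)
    qed
    then have "\<bar>x - z\<bar> * \<bar>k\<bar> \<le> \<tau> * \<bar>z\<bar> * \<bar>k\<bar>" by (rule mult_right_mono) simp
    also have "\<dots> = \<tau> * \<bar>z * k\<bar>" by (simp add: abs_mult)
    also have "\<dots> \<le> \<tau> * (1 + \<eta>)"
    proof (rule mult_left_mono)
      show "\<bar>z * k\<bar> \<le> 1 + \<eta>" using zk assms by linarith
    qed (use \<tau>(1) in simp)
    finally have "\<bar>x * k - z * k\<bar> \<le> \<eta> / 2" using \<tau>(2) by (simp add: abs_mult[symmetric] left_diff_distrib)
    with zk have "\<bar>x * k - 1\<bar> < \<eta>" by linarith
    then have "x \<in> Op (a, c)" unfolding Op_def k_def by simp
    moreover have "(a, c) \<in> P" using ac unfolding P_def by simp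
    ultimately show "x \<in> (\<Union>p\<in>P. Op p)" by blast
  qed
  ultimately obtain F where F: "F \<subseteq> P" "finite F" "closure Z \<subseteq> (\<Union>p\<in>F. Op p)"
    by (rule compactE_image)
  show ?thesis
  proof (rule that[OF F(2)])
    show "wordX a \<and> wordY c" if "(a, c) \<in> F" for a c using that F(1) unfolding P_def by blast
    fix u w assume "wordX u" "wordY w" "balanced R u w"
    then have "Y.slope w / X.slope u \<in> Z" unfolding Z_def by blast
    then have "Y.slope w / X.slope u \<in> (\<Union>p\<in>F. Op p)" using F(3) closure_subset by blast
    then obtain p where "p \<in> F" "Y.slope w / X.slope u \<in> Op p" by blast
    then show "\<exists>(a, c)\<in>F. \<bar>Y.slope (w @ c) / X.slope (u @ a) - 1\<bar> < \<eta>"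
      unfolding Op_def by (intro bexI[of _ p]) (auto simp: case_prod_beta)
  qed
qed

lemma cell_append_subset:
  assumes "wordX v" "wordY v'"
  shows "cell t (u @ v) (w @ v') \<subseteq> cell t u w"
  using X.act_in[OF assms(1)] Y.act_in[OF assms(2)]
  unfolding cell_def proj_def X.act_append Y.act_append by blast

lemma cell_split: "cell t u w = (\<Union>(v, v')\<in>X.words m \<times> Y.words n. cell t (u @ v) (w @ v'))"
proof
  show "(\<Union>(v, v')\<in>X.words m \<times> Y.words n. cell t (u @ v) (w @ v')) \<subseteq> cell t u w"
    using cell_append_subset unfolding X.words_def Y.words_def by blast
  show "cell t u w \<subseteq> (\<Union>(v, v')\<in>X.words m \<times> Y.words n. cell t (u @ v) (w @ v'))"
  proof
    fix z assume "z \<in> cell t u w"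
    then obtain x y where xy: "x \<in> C1" "y \<in> C2" "z = proj t u w x y" unfolding cell_def by blast
    obtain v x' where v: "v \<in> X.words m" "x' \<in> C1" "x = X.act v x'"
      using xy(1) X.attractor_words[of m] by blast
    obtain v' y' where v': "v' \<in> Y.words n" "y' \<in> C2" "y = Y.act v' y'"
      using xy(2) Y.attractor_words[of n] by blast
    have "z = proj t (u @ v) (w @ v') x' y'"
      using xy(3) v(3) v'(3) by (simp add: proj_def X.act_append Y.act_append)
    then have "z \<in> cell t (u @ v) (w @ v')" using v(2) v'(2) unfolding cell_def by blast
    then show "z \<in> (\<Union>(v, v')\<in>X.words m \<times> Y.words n. cell t (u @ v) (w @ v'))" using v(1) v'(1) by blast
  qed
qed

text \<open>
  Up to an affine map of the line, the part of the projection lying over the cylinder \<open>(u, w)\<close> is the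
  projection of the whole product at the new parameter \<open>t * (slope w / slope u)\<close>.
\<close>
lemma proj_append:
  assumes "wordX u"
  shows "proj t (u @ p) (w @ q) x y
    = X.act u 0 + t * Y.act w 0 + X.slope u * proj (t * (Y.slope w / X.slope u)) p q x y"
  using X.slope_nonzero[OF assms] X.act_affine[of u "X.act p x"] Y.act_affine[of w "Y.act q y"]
  by (simp add: proj_def X.act_append Y.act_append field_simps)

lemma cell_append_cball:
  assumes "wordX u" "cell (t * (Y.slope w / X.slope u)) p q \<subseteq> cball c l"
  shows "cell t (u @ p) (w @ q) \<subseteq> cball (X.act u 0 + t * Y.act w 0 + X.slope u * c) (\<bar>X.slope u\<bar> * l)"
proof
  fix z assume "z \<in> cell t (u @ p) (w @ q)"
  then obtain x y where xy: "x \<in> C1" "y \<in> C2" "z = proj t (u @ p) (w @ q) x y" unfolding cell_def by blast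
  define z' where "z' = proj (t * (Y.slope w / X.slope u)) p q x y"
  have "z' \<in> cball c l" using assms(2) xy unfolding cell_def z'_def by blast
  then have "\<bar>X.slope u\<bar> * \<bar>c - z'\<bar> \<le> \<bar>X.slope u\<bar> * l" by (intro mult_left_mono) (auto simp: dist_real_def)
  moreover have "z = X.act u 0 + t * Y.act w 0 + X.slope u * z'"
    using proj_append[OF assms(1)] xy(3) unfolding z'_def by blast
  ultimately show "z \<in> cball (X.act u 0 + t * Y.act w 0 + X.slope u * c) (\<bar>X.slope u\<bar> * l)"
    by (simp add: dist_real_def abs_mult[symmetric] right_diff_distrib)
qed

lemma finite_words_times: "finite (X.words m \<times> Y.words n)"
  using X.finite_words Y.finite_words by simp

lemma mass_words: "mass (X.words m \<times> Y.words n) = 1"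
  unfolding mass_def sum.cartesian_product[symmetric] sum_product[symmetric] X.sum_weight Y.sum_weight by simp

lemma mass_append: "mass ((\<lambda>(p, q). (u @ p, w @ q)) ` Q) = X.weight u * Y.weight w * mass Q"
proof -
  have "inj_on (\<lambda>(p, q). (u @ p, w @ q)) Q" by (auto simp: inj_on_def)
  then show ?thesis
    unfolding mass_def by (subst sum.reindex) (auto simp: sum_distrib_left case_prod_beta intro!: sum.cong)
qed

lemma mass_nonneg: "0 \<le> mass Q"
  unfolding mass_def by (intro sum_nonneg) (auto simp: X.weight_nonneg Y.weight_nonneg)

text \<open>
  Replacing each pair of a family by all its prolongations by a fixed number of letters does not change
  the total weight.
\<close>
lemma mass_refine:
  assumes Q: "Q \<subseteq> X.words m \<times> Y.words n"
  shows "mass ((\<lambda>((p, q), (e, f)). (p @ e, q @ f)) ` (Q \<times> (X.words i \<times> Y.words j))) = mass Q"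
proof -
  have "inj_on (\<lambda>((p, q), (e, f)). (p @ e, q @ f)) (Q \<times> (X.words i \<times> Y.words j))"
  proof (rule inj_onI)
    fix z z' assume zz: "z \<in> Q \<times> (X.words i \<times> Y.words j)" "z' \<in> Q \<times> (X.words i \<times> Y.words j)"
      "(\<lambda>((p, q), (e, f)). (p @ e, q @ f)) z = (\<lambda>((p, q), (e, f)). (p @ e, q @ f)) z'"
    obtain p q e f p' q' e' f' where z: "z = ((p, q), (e, f))" "z' = ((p', q'), (e', f'))"
      by (metis surj_pair)
    have h: "(p, q) \<in> Q" "(p', q') \<in> Q" "p @ e = p' @ e'" "q @ f = q' @ f'"
      using zz unfolding z by auto
    have "length p = length p'" "length q = length q'"
      using h(1,2) Q unfolding X.words_def Y.words_def by auto
    then show "z = z'" using h(3,4) unfolding z by simp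
  qed
  then have "mass ((\<lambda>((p, q), (e, f)). (p @ e, q @ f)) ` (Q \<times> (X.words i \<times> Y.words j)))
    = (\<Sum>(x, y)\<in>Q \<times> (X.words i \<times> Y.words j). (X.weight (fst x) * Y.weight (snd x)) * (X.weight (fst y) * Y.weight (snd y)))"
    unfolding mass_def by (subst sum.reindex) (auto simp: case_prod_beta mult_ac intro!: sum.cong)
  also have "\<dots> = mass Q * mass (X.words i \<times> Y.words j)"
    unfolding mass_def sum_product sum.cartesian_product case_prod_beta by simp
  finally show ?thesis using mass_words by simp
qed

text \<open>
  Being clustered is an open condition: the same family works for nearby parameters, with a slightly
  longer interval.
\<close>
lemma cluster_robust:
  assumes Q: "\<forall>(u, w)\<in>Q. cell t u w \<subseteq> cball c l" "Q \<subseteq> X.words m \<times> Y.words n"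
    and l: "0 < l" "(2 * l) powr s < K"
  obtains l' \<eta> where "0 < l'" "0 < \<eta>" "(2 * l') powr s < K"
    "\<And>t' u w. \<bar>t' - t\<bar> \<le> \<eta> \<Longrightarrow> (u, w) \<in> Q \<Longrightarrow> cell t' u w \<subseteq> cball c l'"
proof -
  obtain L where L: "0 < L" "\<And>y. y \<in> C2 \<Longrightarrow> \<bar>y\<bar> \<le> L" using Y.bound_exists by blast
  have "isCont (\<lambda>z. (2 * z) powr s) l" using l by (intro continuous_intros) auto
  then have "\<forall>\<^sub>F z in at l. (2 * z) powr s < K"
    unfolding isCont_def using l(2) by (rule order_tendstoD(2))
  then obtain d where d: "0 < d" "\<And>z. z \<noteq> l \<Longrightarrow> dist z l < d \<Longrightarrow> (2 * z) powr s < K"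
    unfolding eventually_at by auto
  show ?thesis
  proof (rule that[of "l + d / 2" "d / (2 * L)"])
    show "0 < l + d / 2" "0 < d / (2 * L)" using l d L by auto
    show "(2 * (l + d / 2)) powr s < K" using d by (intro d(2)) (auto simp: dist_real_def)
    fix t' u w assume t': "\<bar>t' - t\<bar> \<le> d / (2 * L)" and uw: "(u, w) \<in> Q"
    have w: "wordY w" using uw Q(2) unfolding Y.words_def by auto
    show "cell t' u w \<subseteq> cball c (l + d / 2)"
    proof
      fix z assume "z \<in> cell t' u w"
      then obtain x y where xy: "x \<in> C1" "y \<in> C2" "z = proj t' u w x y" unfolding cell_def by blast
      have "proj t u w x y \<in> cball c l" using Q(1) uw xy unfolding cell_def by blast
      moreover have "\<bar>z - proj t u w x y\<bar> \<le> d / 2"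
      proof -
        have "\<bar>t' - t\<bar> * \<bar>Y.act w y\<bar> \<le> d / (2 * L) * L"
          using t' L(1) L(2)[OF Y.act_in[OF w xy(2)]] d(1) by (intro mult_mono) auto
        moreover have "z - proj t u w x y = (t' - t) * Y.act w y"
          using xy by (simp add: proj_def algebra_simps)
        ultimately show ?thesis using L(1) by (simp add: abs_mult)
      qed
      ultimately show "z \<in> cball c (l + d / 2)" unfolding mem_cball dist_real_def by linarith
    qed
  qed
qed

section \<open>Clusters give cheap covers\<close>

text \<open>
  Bounds for the contraction ratios of both systems at once.
\<close>
definition lo :: real where "lo = min X.lo Y.lo"
definition hi :: real where "hi = max X.hi Y.hi"

lemma lo_hi: "0 < lo" "lo < 1" "0 < hi" "hi < 1" "lo \<le> X.lo" "lo \<le> Y.lo" "X.hi \<le> hi" "Y.hi \<le> hi"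
  using X.lo_hi(1,2,5,6) Y.lo_hi(1,2,5,6) unfolding lo_def hi_def by auto

lemma words_length_1:
  "v \<in> X.words 1 \<Longrightarrow> wordX v \<and> lo \<le> \<bar>X.slope v\<bar> \<and> \<bar>X.slope v\<bar> \<le> hi"
  "w \<in> Y.words 1 \<Longrightarrow> wordY w \<and> lo \<le> \<bar>Y.slope w\<bar> \<and> \<bar>Y.slope w\<bar> \<le> hi"
  using X.slope_bounds[of v] Y.slope_bounds[of w] lo_hi by (auto simp: X.words_def Y.words_def)

lemma cell_split_X: "cell t u w = (\<Union>v\<in>X.words 1. cell t (u @ v) w)"
  by (subst cell_split[where m = 1 and n = 0]) (auto simp: Y.words_0)

lemma cell_split_Y: "cell t u w = (\<Union>v\<in>Y.words 1. cell t u (w @ v))"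
  by (subst cell_split[where m = 0 and n = 1]) (auto simp: X.words_0)

text \<open>
  A covering bound proportional to the weight need only be checked on balanced cells: an unbalanced
  cell is cut along its longer side until all its parts are balanced.  The cuts never overshoot, since
  one letter changes a slope by at most the factor \<open>1 / lo\<close>.
\<close>
lemma coverable_all_of_balanced:
  assumes bal: "\<And>u w. wordX u \<Longrightarrow> wordY w \<Longrightarrow> \<bar>X.slope u\<bar> \<le> \<rho> \<Longrightarrow> \<bar>Y.slope w\<bar> \<le> \<rho> \<Longrightarrow>
      balanced (1 / lo) u w \<Longrightarrow> coverable s \<delta> (M * (X.weight u * Y.weight w)) (cell t u w)"
    and uw: "wordX u" "wordY w" "\<bar>X.slope u\<bar> \<le> \<rho>" "\<bar>Y.slope w\<bar> \<le> \<rho>"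
  shows "coverable s \<delta> (M * (X.weight u * Y.weight w)) (cell t u w)"
proof -
  let ?R = "1 / lo"
  \<comment> \<open>\<open>k\<close> bounds the number of cuts that are still needed\<close>
  have main: "coverable s \<delta> (M * (X.weight u * Y.weight w)) (cell t u w)"
    if "wordX u" "wordY w" "\<bar>X.slope u\<bar> \<le> \<rho>" "\<bar>Y.slope w\<bar> \<le> \<rho>"
      "\<bar>X.slope u\<bar> * hi ^ k \<le> ?R * \<bar>Y.slope w\<bar>" "\<bar>Y.slope w\<bar> * hi ^ k \<le> ?R * \<bar>X.slope u\<bar>" for k u w
    using that
  proof (induction k arbitrary: u w)
    case 0
    then show ?case by (intro bal) (auto simp: balanced_def)
  next
    case (Suc k)
    have hk: "0 < hi ^ k" "hi ^ k \<le> 1" using lo_hi(3,4) by (auto intro: power_le_one)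
    have p: "0 < \<bar>X.slope u\<bar>" "0 < \<bar>Y.slope w\<bar>"
      using X.slope_pos[OF Suc.prems(1)] Y.slope_pos[OF Suc.prems(2)] .
    consider "balanced ?R u w" | "?R * \<bar>Y.slope w\<bar> < \<bar>X.slope u\<bar>" | "?R * \<bar>X.slope u\<bar> < \<bar>Y.slope w\<bar>"
      unfolding balanced_def by linarith
    then show ?case
    proof cases
      case 1
      then show ?thesis using bal Suc.prems by blast
    next
      case 2
      have "coverable s \<delta> (M * (X.weight (u @ v) * Y.weight w)) (cell t (u @ v) w)" if "v \<in> X.words 1" for v
      proof (rule Suc.IH)
        have v: "wordX v" "lo \<le> \<bar>X.slope v\<bar>" "\<bar>X.slope v\<bar> \<le> hi" using words_length_1(1)[OF that] by auto
        show "wordX (u @ v)" using v Suc.prems by simp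
        show "wordY w" "\<bar>Y.slope w\<bar> \<le> \<rho>" using Suc.prems by auto
        show "\<bar>X.slope (u @ v)\<bar> \<le> \<rho>"
          using Suc.prems(3) v(3) lo_hi(4) mult_left_mono[of "\<bar>X.slope v\<bar>" 1 "\<bar>X.slope u\<bar>"] by (simp add: abs_mult)
        have "\<bar>X.slope (u @ v)\<bar> * hi ^ k = (\<bar>X.slope u\<bar> * hi ^ k) * \<bar>X.slope v\<bar>" by (simp add: abs_mult mult_ac)
        also have "\<dots> \<le> (\<bar>X.slope u\<bar> * hi ^ k) * hi" using v(3) hk by (intro mult_left_mono) auto
        also have "\<dots> \<le> ?R * \<bar>Y.slope w\<bar>" using Suc.prems(5) by (simp add: mult_ac)
        finally show "\<bar>X.slope (u @ v)\<bar> * hi ^ k \<le> ?R * \<bar>Y.slope w\<bar>" .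
        have "\<bar>Y.slope w\<bar> * hi ^ k \<le> \<bar>Y.slope w\<bar> * 1" using hk by (intro mult_left_mono) auto
        also have "\<dots> \<le> lo * \<bar>X.slope u\<bar>" using 2 lo_hi(1) by (simp add: field_simps)
        also have "\<dots> \<le> \<bar>X.slope v\<bar> * \<bar>X.slope u\<bar>" using v(2) by (intro mult_right_mono) auto
        also have "\<dots> = 1 * \<bar>X.slope (u @ v)\<bar>" by (simp add: abs_mult)
        also have "\<dots> \<le> ?R * \<bar>X.slope (u @ v)\<bar>" using lo_hi by (intro mult_right_mono) auto
        finally show "\<bar>Y.slope w\<bar> * hi ^ k \<le> ?R * \<bar>X.slope (u @ v)\<bar>" .
      qed
      then have "coverable s \<delta> (\<Sum>v\<in>X.words 1. M * (X.weight (u @ v) * Y.weight w)) (cell t u w)"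
        unfolding cell_split_X[of t u w] by (intro coverable_UN X.finite_words)
      also have "(\<Sum>v\<in>X.words 1. M * (X.weight (u @ v) * Y.weight w))
          = M * (X.weight u * Y.weight w) * (\<Sum>v\<in>X.words 1. X.weight v)"
        unfolding sum_distrib_left by (intro sum.cong) (auto simp: mult_ac)
      finally show ?thesis by (simp only: X.sum_weight mult_1_right)
    next
      case 3
      have "coverable s \<delta> (M * (X.weight u * Y.weight (w @ v))) (cell t u (w @ v))" if "v \<in> Y.words 1" for v
      proof (rule Suc.IH)
        have v: "wordY v" "lo \<le> \<bar>Y.slope v\<bar>" "\<bar>Y.slope v\<bar> \<le> hi" using words_length_1(2)[OF that] by auto
        show "wordY (w @ v)" using v Suc.prems by simp
        show "wordX u" "\<bar>X.slope u\<bar> \<le> \<rho>" using Suc.prems by auto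
        show "\<bar>Y.slope (w @ v)\<bar> \<le> \<rho>"
          using Suc.prems(4) v(3) lo_hi(4) mult_left_mono[of "\<bar>Y.slope v\<bar>" 1 "\<bar>Y.slope w\<bar>"] by (simp add: abs_mult)
        have "\<bar>Y.slope (w @ v)\<bar> * hi ^ k = (\<bar>Y.slope w\<bar> * hi ^ k) * \<bar>Y.slope v\<bar>" by (simp add: abs_mult mult_ac)
        also have "\<dots> \<le> (\<bar>Y.slope w\<bar> * hi ^ k) * hi" using v(3) hk by (intro mult_left_mono) auto
        also have "\<dots> \<le> ?R * \<bar>X.slope u\<bar>" using Suc.prems(6) by (simp add: mult_ac)
        finally show "\<bar>Y.slope (w @ v)\<bar> * hi ^ k \<le> ?R * \<bar>X.slope u\<bar>" .
        have "\<bar>X.slope u\<bar> * hi ^ k \<le> \<bar>X.slope u\<bar> * 1" using hk by (intro mult_left_mono) auto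
        also have "\<dots> \<le> lo * \<bar>Y.slope w\<bar>" using 3 lo_hi(1) by (simp add: field_simps)
        also have "\<dots> \<le> \<bar>Y.slope v\<bar> * \<bar>Y.slope w\<bar>" using v(2) by (intro mult_right_mono) auto
        also have "\<dots> = 1 * \<bar>Y.slope (w @ v)\<bar>" by (simp add: abs_mult)
        also have "\<dots> \<le> ?R * \<bar>Y.slope (w @ v)\<bar>" using lo_hi by (intro mult_right_mono) auto
        finally show "\<bar>X.slope u\<bar> * hi ^ k \<le> ?R * \<bar>Y.slope (w @ v)\<bar>" .
      qed
      then have "coverable s \<delta> (\<Sum>v\<in>Y.words 1. M * (X.weight u * Y.weight (w @ v))) (cell t u w)"
        unfolding cell_split_Y[of t u w] by (intro coverable_UN Y.finite_words)
      also have "(\<Sum>v\<in>Y.words 1. M * (X.weight u * Y.weight (w @ v)))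
          = M * (X.weight u * Y.weight w) * (\<Sum>v\<in>Y.words 1. Y.weight v)"
        unfolding sum_distrib_left by (intro sum.cong) (auto simp: mult_ac)
      finally show ?thesis by (simp only: Y.sum_weight mult_1_right)
    qed
  qed
  have p: "0 < ?R * \<bar>X.slope u\<bar>" "0 < ?R * \<bar>Y.slope w\<bar>"
    using X.slope_pos[OF uw(1)] Y.slope_pos[OF uw(2)] lo_hi(1) by auto
  obtain k where k: "hi ^ k < min (?R * \<bar>X.slope u\<bar>) (?R * \<bar>Y.slope w\<bar>)"
    using real_arch_pow_inv[of "min (?R * \<bar>X.slope u\<bar>) (?R * \<bar>Y.slope w\<bar>)" hi] p lo_hi(4) by auto
  have "\<bar>X.slope u\<bar> * hi ^ k \<le> 1 * hi ^ k" "\<bar>Y.slope w\<bar> * hi ^ k \<le> 1 * hi ^ k"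
    using X.slope_le_1[OF uw(1)] Y.slope_le_1[OF uw(2)] lo_hi(3) by (intro mult_right_mono; simp)+
  then show ?thesis using k by (intro main[OF uw, of k]) auto
qed

text \<open>
  The cost of an interval comparable to a balanced cell is at most a constant times the weight of the cell.
\<close>
lemma balanced_cost:
  assumes "wordX u" "wordY w" "\<bar>X.slope u\<bar> \<le> R * \<bar>Y.slope w\<bar>" "0 \<le> K" "0 \<le> R"
  shows "(2 * (\<bar>X.slope u\<bar> * K)) powr (d1 + d2) \<le> (2 * K) powr (d1 + d2) * R powr d2 * (X.weight u * Y.weight w)"
proof -
  have "\<bar>X.slope u\<bar> powr d2 \<le> (R * \<bar>Y.slope w\<bar>) powr d2"
    using assms Y.dim_nonneg by (intro powr_mono2) auto
  also have "\<dots> = R powr d2 * \<bar>Y.slope w\<bar> powr d2" using assms by (simp add: powr_mult)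
  finally have "\<bar>X.slope u\<bar> powr d1 * \<bar>X.slope u\<bar> powr d2 \<le> \<bar>X.slope u\<bar> powr d1 * (R powr d2 * \<bar>Y.slope w\<bar> powr d2)"
    by (rule mult_left_mono) simp
  then have "\<bar>X.slope u\<bar> powr (d1 + d2) \<le> R powr d2 * (X.weight u * Y.weight w)"
    unfolding powr_add X.weight_def Y.weight_def by (simp add: mult_ac)
  then have "(2 * K) powr (d1 + d2) * \<bar>X.slope u\<bar> powr (d1 + d2)
      \<le> (2 * K) powr (d1 + d2) * (R powr d2 * (X.weight u * Y.weight w))" by (intro mult_left_mono) auto
  moreover have "(2 * (\<bar>X.slope u\<bar> * K)) powr (d1 + d2) = (2 * K) powr (d1 + d2) * \<bar>X.slope u\<bar> powr (d1 + d2)"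
    using assms by (simp add: powr_mult[symmetric] mult_ac)
  ultimately show ?thesis by (simp add: mult_ac)
qed

lemma cell_subset_cball:
  obtains L where "0 < L" "\<And>t. cell t [] [] \<subseteq> cball 0 (L * (1 + \<bar>t\<bar>))"
proof -
  obtain L1 where L1: "0 < L1" "\<And>x. x \<in> C1 \<Longrightarrow> \<bar>x\<bar> \<le> L1" using X.bound_exists by blast
  obtain L2 where L2: "0 < L2" "\<And>x. x \<in> C2 \<Longrightarrow> \<bar>x\<bar> \<le> L2" using Y.bound_exists by blast
  show ?thesis
  proof (rule that[of "L1 + L2"])
    show "cell t [] [] \<subseteq> cball 0 ((L1 + L2) * (1 + \<bar>t\<bar>))" for t
    proof
      fix z assume "z \<in> cell t [] []"
      then obtain x y where xy: "x \<in> C1" "y \<in> C2" "z = x + t * y"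
        unfolding cell_def proj_def by (auto simp: X.act_def Y.act_def)
      have "\<bar>t * y\<bar> \<le> \<bar>t\<bar> * L2" using L2(2)[OF xy(2)] by (simp add: abs_mult mult_left_mono)
      moreover have "0 \<le> \<bar>t\<bar> * L1" using L1(1) by simp
      moreover have "(L1 + L2) * (1 + \<bar>t\<bar>) = L1 + L2 + \<bar>t\<bar> * L1 + \<bar>t\<bar> * L2" by (simp add: algebra_simps)
      ultimately have "\<bar>z\<bar> \<le> (L1 + L2) * (1 + \<bar>t\<bar>)"
        using L1(2)[OF xy(1)] L2(1) xy(3) by linarith
      then show "z \<in> cball 0 ((L1 + L2) * (1 + \<bar>t\<bar>))" by simp
    qed
  qed (use L1 L2 in simp)
qed

text \<open>
  The trivial bound: cover each balanced cell by one interval.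
\<close>
lemma coverable_initial:
  assumes "0 < \<delta>"
  obtains M \<rho> where "0 \<le> M" "0 < \<rho>"
    "\<And>u w. wordX u \<Longrightarrow> wordY w \<Longrightarrow> \<bar>X.slope u\<bar> \<le> \<rho> \<Longrightarrow> \<bar>Y.slope w\<bar> \<le> \<rho> \<Longrightarrow>
      coverable (d1 + d2) \<delta> (M * (X.weight u * Y.weight w)) (cell t u w)"
proof -
  obtain L where L: "0 < L" "\<And>t. cell t [] [] \<subseteq> cball 0 (L * (1 + \<bar>t\<bar>))" using cell_subset_cball by blast
  define R where "R = 1 / lo"
  define K where "K = L * (1 + \<bar>t\<bar> * R)"
  have R: "0 < R" using lo_hi(1) by (simp add: R_def)
  have K: "0 < K" unfolding K_def using L R by (intro mult_pos_pos add_pos_nonneg) auto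
  define M where "M = (2 * K) powr (d1 + d2) * R powr d2"
  define \<rho> where "\<rho> = \<delta> / (2 * K)"
  have "coverable (d1 + d2) \<delta> (M * (X.weight u * Y.weight w)) (cell t u w)"
    if uw: "wordX u" "wordY w" "\<bar>X.slope u\<bar> \<le> \<rho>" "\<bar>Y.slope w\<bar> \<le> \<rho>" "balanced (1 / lo) u w" for u w
  proof -
    let ?t = "t * (Y.slope w / X.slope u)"
    have "\<bar>Y.slope w / X.slope u\<bar> \<le> R"
      using uw(5) X.slope_pos[OF uw(1)] unfolding balanced_def R_def by (simp add: abs_divide pos_divide_le_eq)
    then have "\<bar>?t\<bar> \<le> \<bar>t\<bar> * R" unfolding abs_mult by (intro mult_left_mono) auto
    then have "L * (1 + \<bar>?t\<bar>) \<le> K" unfolding K_def using L(1) by (intro mult_left_mono) auto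
    then have "cell ?t [] [] \<subseteq> cball 0 K" using L(2)[of ?t] by (meson order.trans subset_cball)
    from cell_append_cball[OF uw(1) this]
    have "cell t u w \<subseteq> cball (X.act u 0 + t * Y.act w 0 + X.slope u * 0) (\<bar>X.slope u\<bar> * K)" by simp
    then show ?thesis
    proof (rule coverable_cball[rotated 2])
      show "0 < \<bar>X.slope u\<bar> * K" using X.slope_pos[OF uw(1)] K by simp
      show "2 * (\<bar>X.slope u\<bar> * K) \<le> \<delta>" using uw(3) K unfolding \<rho>_def by (simp add: field_simps)
      show "(2 * (\<bar>X.slope u\<bar> * K)) powr (d1 + d2) \<le> M * (X.weight u * Y.weight w)"
        unfolding M_def using uw(5) K R
        by (intro balanced_cost[OF uw(1,2)]) (auto simp: balanced_def R_def)
    qed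
  qed
  then have "coverable (d1 + d2) \<delta> (M * (X.weight u * Y.weight w)) (cell t u w)"
    if "wordX u" "wordY w" "\<bar>X.slope u\<bar> \<le> \<rho>" "\<bar>Y.slope w\<bar> \<le> \<rho>" for u w
    using coverable_all_of_balanced[of \<rho> "d1 + d2" \<delta> M t u w] that by blast
  moreover have "0 \<le> M" "0 < \<rho>" using K R assms by (auto simp: M_def \<rho>_def)
  ultimately show ?thesis using that by blast
qed

text \<open>
  One improvement step.  The prolongation \<open>(a, a')\<close> brings the parameter of the cell \<open>(u, w)\<close> back
  to nearly \<open>t\<close>, so the cluster \<open>Q\<close> of \<open>t\<close> reappears inside the cell.  Covering this copy by a single
  interval costs \<open>2 * \<epsilon>\<close> per unit of weight instead of \<open>M\<close>, and the copy carries at least the proportion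
  \<open>\<kappa>\<close> of the weight of the cell.
\<close>
lemma coverable_improve:
  assumes Q: "Q \<subseteq> X.words m \<times> Y.words n" and l: "0 < l" and small: "(2 * l) powr (d1 + d2) \<le> \<epsilon> * mass Q"
    and near: "\<And>t' p q. \<bar>t' - t\<bar> \<le> \<eta> \<Longrightarrow> (p, q) \<in> Q \<Longrightarrow> cell t' p q \<subseteq> cball c l"
    and ac: "wordX a" "wordY a'" "\<bar>t * (Y.slope (w @ a') / X.slope (u @ a)) - t\<bar> \<le> \<eta>"
      "\<bar>X.slope (u @ a)\<bar> \<le> R * \<bar>Y.slope (w @ a')\<bar>" "0 \<le> R" "R powr d2 \<le> 2"
    and uw: "wordX u" "wordY w" "\<bar>X.slope u\<bar> \<le> \<rho>" "\<bar>Y.slope w\<bar> \<le> \<rho>"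
    and \<rho>: "2 * (\<rho> * l) \<le> \<delta>" and \<epsilon>: "0 \<le> \<epsilon>"
    and M: "\<And>u w. wordX u \<Longrightarrow> wordY w \<Longrightarrow> \<bar>X.slope u\<bar> \<le> \<rho> \<Longrightarrow> \<bar>Y.slope w\<bar> \<le> \<rho> \<Longrightarrow>
      coverable (d1 + d2) \<delta> (M * (X.weight u * Y.weight w)) (cell t u w)"
    and \<kappa>: "\<kappa> \<le> X.weight a * Y.weight a' * mass Q" and M\<epsilon>: "2 * \<epsilon> \<le> M"
  shows "coverable (d1 + d2) \<delta> ((M - \<kappa> * (M - 2 * \<epsilon>)) * (X.weight u * Y.weight w)) (cell t u w)"
proof -
  let ?W = "X.weight u * Y.weight w"
  define All where "All = X.words (length a + m) \<times> Y.words (length a' + n)"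
  define Cl where "Cl = (\<lambda>(p, q). (a @ p, a' @ q)) ` Q"
  define Z where "Z = (\<Union>(p, q)\<in>Q. cell t (u @ a @ p) (w @ a' @ q))"
  have fin: "finite All" unfolding All_def by (rule finite_words_times)
  have sub: "Cl \<subseteq> All"
  proof -
    have "a \<in> X.words (length a)" "a' \<in> Y.words (length a')"
      using ac(1,2) unfolding X.words_def Y.words_def by auto
    then have "(a @ p, a' @ q) \<in> All" if "(p, q) \<in> Q" for p q
      using that Q unfolding All_def by (auto intro: X.words_append Y.words_append)
    then show ?thesis unfolding Cl_def by auto
  qed
  have mCl: "mass Cl = X.weight a * Y.weight a' * mass Q" unfolding Cl_def by (rule mass_append)
  have wa: "wordX (u @ a)" "wordY (w @ a')" using ac uw by auto
  \<comment> \<open>\<open>Cl\<close> is the copy of the cluster, \<open>Z\<close> the union of its cells, and \<open>All\<close> the generation it belongs to\<close>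
  have Zcov: "coverable (d1 + d2) \<delta> (2 * \<epsilon> * mass Cl * ?W) Z"
  proof (rule coverable_cball)
    show "0 < \<bar>X.slope (u @ a)\<bar> * l" using X.slope_pos[OF wa(1)] l by simp
    have "\<bar>X.slope (u @ a)\<bar> \<le> \<rho>"
      using uw(3) X.slope_le_1[OF ac(1)] mult_left_mono[of "\<bar>X.slope a\<bar>" 1 "\<bar>X.slope u\<bar>"] by (simp add: abs_mult)
    then have "\<bar>X.slope (u @ a)\<bar> * l \<le> \<rho> * l" using l by (intro mult_right_mono) auto
    then show "2 * (\<bar>X.slope (u @ a)\<bar> * l) \<le> \<delta>" using \<rho> by linarith
    show "Z \<subseteq> cball (X.act (u @ a) 0 + t * Y.act (w @ a') 0 + X.slope (u @ a) * c) (\<bar>X.slope (u @ a)\<bar> * l)"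
      unfolding Z_def
    proof (rule UN_least, clarify)
      fix p q z assume pq: "(p, q) \<in> Q" and z: "z \<in> cell t (u @ a @ p) (w @ a' @ q)"
      show "z \<in> cball (X.act (u @ a) 0 + t * Y.act (w @ a') 0 + X.slope (u @ a) * c) (\<bar>X.slope (u @ a)\<bar> * l)"
        using cell_append_cball[OF wa(1) near[OF ac(3) pq]] z unfolding append_assoc by blast
    qed
    have "(2 * (\<bar>X.slope (u @ a)\<bar> * l)) powr (d1 + d2)
        \<le> (2 * l) powr (d1 + d2) * R powr d2 * (X.weight (u @ a) * Y.weight (w @ a'))"
      using l ac(4,5) by (intro balanced_cost[OF wa]) auto
    also have "\<dots> \<le> (\<epsilon> * mass Q) * 2 * (X.weight (u @ a) * Y.weight (w @ a'))"
      using small ac(6) \<epsilon> mass_nonneg[of Q]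
      by (intro mult_right_mono mult_mono) (auto simp: X.weight_nonneg Y.weight_nonneg)
    also have "\<dots> = 2 * \<epsilon> * mass Cl * ?W" unfolding mCl by simp
    finally show "(2 * (\<bar>X.slope (u @ a)\<bar> * l)) powr (d1 + d2) \<le> 2 * \<epsilon> * mass Cl * ?W" .
  qed
  have small_cell: "coverable (d1 + d2) \<delta> (M * (X.weight (u @ fst z) * Y.weight (w @ snd z))) (cell t (u @ fst z) (w @ snd z))"
    if "z \<in> All - Cl" for z
  proof (rule M)
    have z: "wordX (fst z)" "wordY (snd z)" using that unfolding All_def X.words_def Y.words_def by auto
    then show "wordX (u @ fst z)" "wordY (w @ snd z)" using uw by auto
    show "\<bar>X.slope (u @ fst z)\<bar> \<le> \<rho>"
      using uw(3) X.slope_le_1[OF z(1)] mult_left_mono[of "\<bar>X.slope (fst z)\<bar>" 1 "\<bar>X.slope u\<bar>"] by (simp add: abs_mult)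
    show "\<bar>Y.slope (w @ snd z)\<bar> \<le> \<rho>"
      using uw(4) Y.slope_le_1[OF z(2)] mult_left_mono[of "\<bar>Y.slope (snd z)\<bar>" 1 "\<bar>Y.slope w\<bar>"] by (simp add: abs_mult)
  qed
  have eq1: "(\<Sum>z\<in>All - Cl. M * (X.weight (u @ fst z) * Y.weight (w @ snd z)))
      = M * ?W * mass (All - Cl)"
    unfolding mass_def sum_distrib_left by (intro sum.cong) (auto simp: mult_ac case_prod_beta)
  have eq2: "mass (All - Cl) = 1 - mass Cl"
    unfolding mass_words[of "length a + m" "length a' + n", symmetric] All_def[symmetric]
    unfolding mass_def by (rule sum_diff[OF fin sub])
  have "coverable (d1 + d2) \<delta> (\<Sum>z\<in>All - Cl. M * (X.weight (u @ fst z) * Y.weight (w @ snd z)))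
      (\<Union>z\<in>All - Cl. cell t (u @ fst z) (w @ snd z))"
    using fin by (intro coverable_UN finite_Diff small_cell)
  then have "coverable (d1 + d2) \<delta> (M * ?W * (1 - mass Cl)) (\<Union>z\<in>All - Cl. cell t (u @ fst z) (w @ snd z))"
    unfolding eq1 eq2 .
  from coverable_Un[OF Zcov this] show ?thesis
  proof (rule coverable_mono)
    have "Z = (\<Union>z\<in>Cl. cell t (u @ fst z) (w @ snd z))" unfolding Z_def Cl_def by auto
    moreover have "cell t u w = (\<Union>z\<in>All. cell t (u @ fst z) (w @ snd z))"
      unfolding All_def case_prod_beta[symmetric] by (subst cell_split) (auto simp: case_prod_beta)
    ultimately show "cell t u w \<subseteq> Z \<union> (\<Union>z\<in>All - Cl. cell t (u @ fst z) (w @ snd z))" by blast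
    have "\<kappa> * (M - 2 * \<epsilon>) \<le> mass Cl * (M - 2 * \<epsilon>)"
      using \<kappa> M\<epsilon> unfolding mCl by (intro mult_right_mono) auto
    then have "2 * \<epsilon> * mass Cl + M * (1 - mass Cl) \<le> M - \<kappa> * (M - 2 * \<epsilon>)" by (simp add: algebra_simps)
    then have "(2 * \<epsilon> * mass Cl + M * (1 - mass Cl)) * ?W \<le> (M - \<kappa> * (M - 2 * \<epsilon>)) * ?W"
      by (intro mult_right_mono) (auto simp: X.weight_nonneg Y.weight_nonneg)
    then show "2 * \<epsilon> * mass Cl * ?W + M * ?W * (1 - mass Cl) \<le> (M - \<kappa> * (M - 2 * \<epsilon>)) * ?W"
      by (simp add: algebra_simps)
  qed
qed

text \<open>
  Iterating the improvement, the constant \<open>M\<close> tends to \<open>2 * \<epsilon>\<close>.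
\<close>
lemma clustered_coverable:
  assumes cl: "clustered \<epsilon> t" and \<epsilon>: "0 < \<epsilon>" and \<delta>: "0 < \<delta>"
  shows "coverable (d1 + d2) \<delta> (3 * \<epsilon>) (cell t [] [])"
proof -
  obtain m n Q c l0 where Q: "Q \<subseteq> X.words m \<times> Y.words n" "\<forall>(u, w)\<in>Q. cell t u w \<subseteq> cball c l0"
    and l0: "0 < l0" "(2 * l0) powr (d1 + d2) < \<epsilon> * mass Q"
    using cl unfolding clustered_def by blast
  obtain l \<eta> where l: "0 < l" "0 < \<eta>" "(2 * l) powr (d1 + d2) < \<epsilon> * mass Q"
    "\<And>t' u w. \<bar>t' - t\<bar> \<le> \<eta> \<Longrightarrow> (u, w) \<in> Q \<Longrightarrow> cell t' u w \<subseteq> cball c l"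
    using cluster_robust[OF Q(2,1) l0] by blast
  have "0 < \<epsilon> * mass Q" using l(3) by (meson le_less_trans powr_ge_zero)
  then have mQ: "0 < mass Q" using \<epsilon> by (simp add: zero_less_mult_iff)
  \<comment> \<open>the tolerance \<open>e\<close> for slope ratios keeps the parameter within \<open>\<eta>\<close> of \<open>t\<close> and costs a factor of at most 2\<close>
  have "isCont (\<lambda>z. (1 / (1 - z)) powr d2) 0" by (intro continuous_intros) auto
  then have "\<forall>\<^sub>F z in at 0. (1 / (1 - z)) powr d2 < 2"
    unfolding isCont_def by (rule order_tendstoD(2)) simp
  then obtain e0 where e0: "0 < e0" "\<And>z::real. z \<noteq> 0 \<Longrightarrow> \<bar>z\<bar> < e0 \<Longrightarrow> (1 / (1 - z)) powr d2 < 2"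
    unfolding eventually_at by (auto simp: dist_real_def)
  define e where "e = min (min (e0 / 2) (1 / 2)) (\<eta> / (1 + \<bar>t\<bar>))"
  have e: "0 < e" "e < e0" "e < 1" "e \<le> \<eta> / (1 + \<bar>t\<bar>)" using e0 l(2) unfolding e_def by auto
  define R where "R = 1 / (1 - e)"
  have R: "0 \<le> R" "R powr d2 \<le> 2" using e e0(2)[of e] unfolding R_def by auto
  obtain F where F: "finite F" "\<And>a a'. (a, a') \<in> F \<Longrightarrow> wordX a \<and> wordY a'"
    "\<And>u w. wordX u \<Longrightarrow> wordY w \<Longrightarrow> balanced (1 / lo) u w \<Longrightarrow>
       \<exists>(a, a')\<in>F. \<bar>Y.slope (w @ a') / X.slope (u @ a) - 1\<bar> < e"
  proof (rule finitely_many_return_words[OF e(1), where R = "1 / lo"])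
    fix F assume F: "finite F" "\<And>a c. (a, c) \<in> F \<Longrightarrow> wordX a \<and> wordY c"
      "\<And>u w. wordX u \<Longrightarrow> wordY w \<Longrightarrow> balanced (1 / lo) u w \<Longrightarrow>
         \<exists>(a, c)\<in>F. \<bar>Y.slope (w @ c) / X.slope (u @ a) - 1\<bar> < e"
    show thesis by (rule that[OF F])
  qed
  define \<kappa> where "\<kappa> = Min (insert 1 ((\<lambda>(a, a'). X.weight a * Y.weight a' * mass Q) ` F))"
  have \<kappa>: "0 < \<kappa>" "\<kappa> \<le> 1" "\<And>a a'. (a, a') \<in> F \<Longrightarrow> \<kappa> \<le> X.weight a * Y.weight a' * mass Q"
  proof -
    have fin: "finite (insert 1 ((\<lambda>(a, a'). X.weight a * Y.weight a' * mass Q) ` F))" using F(1) by simp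
    show "0 < \<kappa>" unfolding \<kappa>_def
    proof (subst Min_gr_iff[OF fin], simp, rule ballI)
      fix z assume "z \<in> insert 1 ((\<lambda>(a, a'). X.weight a * Y.weight a' * mass Q) ` F)"
      then show "0 < z" using F(2) X.weight_pos Y.weight_pos mQ by auto
    qed
    show "\<kappa> \<le> 1" unfolding \<kappa>_def using fin by (intro Min_le) auto
    show "\<kappa> \<le> X.weight a * Y.weight a' * mass Q" if "(a, a') \<in> F" for a a'
      unfolding \<kappa>_def using fin that by (intro Min_le) auto
  qed
  obtain M0 \<rho>0 where M0: "0 \<le> M0" "0 < \<rho>0"
    "\<And>u w. wordX u \<Longrightarrow> wordY w \<Longrightarrow> \<bar>X.slope u\<bar> \<le> \<rho>0 \<Longrightarrow> \<bar>Y.slope w\<bar> \<le> \<rho>0 \<Longrightarrow>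
      coverable (d1 + d2) \<delta> (M0 * (X.weight u * Y.weight w)) (cell t u w)"
  proof (rule coverable_initial[OF \<delta>, where t = t])
    fix M \<rho> assume M: "0 \<le> M" "0 < \<rho>"
      "\<And>u w. wordX u \<Longrightarrow> wordY w \<Longrightarrow> \<bar>X.slope u\<bar> \<le> \<rho> \<Longrightarrow> \<bar>Y.slope w\<bar> \<le> \<rho> \<Longrightarrow>
        coverable (d1 + d2) \<delta> (M * (X.weight u * Y.weight w)) (cell t u w)"
    show thesis by (rule that[OF M])
  qed
  define \<rho> where "\<rho> = min \<rho>0 (\<delta> / (2 * l))"
  have \<rho>: "0 < \<rho>" "\<rho> \<le> \<rho>0" "2 * (\<rho> * l) \<le> \<delta>"
    using M0(2) \<delta> l(1) unfolding \<rho>_def by (auto simp: min_def field_simps)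
  define M where "M k = 2 * \<epsilon> + (1 - \<kappa>) ^ k * max 0 (M0 - 2 * \<epsilon>)" for k :: nat
  have M: "coverable (d1 + d2) \<delta> (M k * (X.weight u * Y.weight w)) (cell t u w)"
    if "wordX u" "wordY w" "\<bar>X.slope u\<bar> \<le> \<rho>" "\<bar>Y.slope w\<bar> \<le> \<rho>" for k u w
    using that
  proof (induction k arbitrary: u w)
    case 0
    have "M0 * (X.weight u * Y.weight w) \<le> M 0 * (X.weight u * Y.weight w)"
      unfolding M_def by (intro mult_right_mono) (auto simp: X.weight_nonneg Y.weight_nonneg)
    then show ?case using M0(3)[OF 0(1,2)] 0(3,4) \<rho>(2) by (meson coverable_mono order.refl order.trans)
  next
    case (Suc k)
    have step: "M (Suc k) = M k - \<kappa> * (M k - 2 * \<epsilon>)" unfolding M_def by (simp add: algebra_simps)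
    show ?case
    proof (rule coverable_all_of_balanced[OF _ Suc.prems])
      fix u w assume uw: "wordX u" "wordY w" "\<bar>X.slope u\<bar> \<le> \<rho>" "\<bar>Y.slope w\<bar> \<le> \<rho>" "balanced (1 / lo) u w"
      obtain a a' where a: "(a, a') \<in> F" "\<bar>Y.slope (w @ a') / X.slope (u @ a) - 1\<bar> < e"
        using F(3)[OF uw(1,2,5)] by blast
      have wa: "wordX a" "wordY a'" using F(2)[OF a(1)] by auto
      let ?z = "Y.slope (w @ a') / X.slope (u @ a)"
      show "coverable (d1 + d2) \<delta> (M (Suc k) * (X.weight u * Y.weight w)) (cell t u w)"
        unfolding step
      proof (rule coverable_improve[OF Q(1) l(1) less_imp_le[OF l(3)] l(4) wa _ _ R uw(1-4) \<rho>(3) _ Suc.IH \<kappa>(3)[OF a(1)]])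
        have "\<bar>t * ?z - t\<bar> = \<bar>t\<bar> * \<bar>?z - 1\<bar>" by (simp add: abs_mult[symmetric] right_diff_distrib)
        also have "\<dots> \<le> (1 + \<bar>t\<bar>) * e" using a(2) by (intro mult_mono) auto
        also have "\<dots> \<le> \<eta>" using e(4) by (simp add: pos_le_divide_eq mult.commute)
        finally show "\<bar>t * ?z - t\<bar> \<le> \<eta>" .
        have "1 - e \<le> \<bar>?z\<bar>" using a(2) by linarith
        moreover have "\<bar>X.slope (u @ a)\<bar> > 0" using uw wa X.slope_pos[of "u @ a"] by simp
        ultimately have "(1 - e) * \<bar>X.slope (u @ a)\<bar> \<le> \<bar>Y.slope (w @ a')\<bar>"
          unfolding abs_divide by (simp add: pos_le_divide_eq)
        then show "\<bar>X.slope (u @ a)\<bar> \<le> R * \<bar>Y.slope (w @ a')\<bar>"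
          unfolding R_def using e(3) by (simp add: field_simps)
        show "0 \<le> \<epsilon>" using \<epsilon> by simp
        show "2 * \<epsilon> \<le> M k" unfolding M_def using \<kappa>(2) by simp
      qed
    qed
  qed
  have "(\<lambda>k. M k) \<longlonglongrightarrow> 2 * \<epsilon> + 0 * max 0 (M0 - 2 * \<epsilon>)"
    unfolding M_def using \<kappa>(1,2) by (intro tendsto_intros LIMSEQ_power_zero) auto
  then have "\<forall>\<^sub>F k in sequentially. M k < 3 * \<epsilon>" using \<epsilon> by (intro order_tendstoD(2)) auto
  then obtain k where k: "M k < 3 * \<epsilon>" by (metis eventually_sequentially order.refl)
  obtain N where N: "hi ^ N < \<rho>" using real_arch_pow_inv[OF \<rho>(1) lo_hi(4)] by blast
  have small: "wordX (fst z) \<and> wordY (snd z) \<and> \<bar>X.slope (fst z)\<bar> \<le> \<rho> \<and> \<bar>Y.slope (snd z)\<bar> \<le> \<rho>"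
    if "z \<in> X.words N \<times> Y.words N" for z
  proof -
    have z: "wordX (fst z)" "wordY (snd z)" "length (fst z) = N" "length (snd z) = N"
      using that unfolding X.words_def Y.words_def by auto
    have "X.hi ^ N \<le> hi ^ N" "Y.hi ^ N \<le> hi ^ N"
      using lo_hi(7,8) X.lo_hi(5) Y.lo_hi(5) by (auto intro: power_mono)
    then show ?thesis using X.slope_bounds(2)[OF z(1)] Y.slope_bounds(2)[OF z(2)] z N by auto
  qed
  have "coverable (d1 + d2) \<delta> (\<Sum>z\<in>X.words N \<times> Y.words N. M k * (X.weight (fst z) * Y.weight (snd z)))
      (\<Union>z\<in>X.words N \<times> Y.words N. cell t (fst z) (snd z))"
    by (intro coverable_UN finite_words_times M) (use small in auto)
  moreover have "(\<Sum>z\<in>X.words N \<times> Y.words N. M k * (X.weight (fst z) * Y.weight (snd z))) = M k"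
    using mass_words[of N N] unfolding mass_def sum_distrib_left[symmetric] case_prod_beta by simp
  moreover have "(\<Union>z\<in>X.words N \<times> Y.words N. cell t (fst z) (snd z)) = cell t [] []"
    by (subst (2) cell_split[where m = N and n = N]) (auto simp: case_prod_beta)
  ultimately show ?thesis using k by (auto elim: coverable_mono)
qed

section \<open>Small cylinders of equal shape at two points\<close>

lemma ratio_bounds:
  fixes p q \<rho> :: real
  assumes "lo * \<rho> \<le> \<bar>p\<bar>" "\<bar>p\<bar> \<le> \<rho>" "lo * \<rho> \<le> \<bar>q\<bar>" "\<bar>q\<bar> \<le> \<rho>" "0 < \<rho>"
  shows "lo \<le> \<bar>p / q\<bar>" "\<bar>p / q\<bar> \<le> 1 / lo"
proof -
  have q: "0 < \<bar>q\<bar>" using assms lo_hi(1) by (smt (verit) mult_pos_pos)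
  have "lo * \<bar>q\<bar> \<le> lo * \<rho>" using assms lo_hi(1) by (intro mult_left_mono) auto
  then have "lo * \<bar>q\<bar> \<le> \<bar>p\<bar>" using assms by linarith
  then show "lo \<le> \<bar>p / q\<bar>" using q unfolding abs_divide by (simp add: pos_le_divide_eq)
  have "lo * \<bar>p\<bar> \<le> lo * \<rho>" using assms lo_hi(1) by (intro mult_left_mono) auto
  then have "lo * \<bar>p\<bar> \<le> \<bar>q\<bar>" using assms by linarith
  then show "\<bar>p / q\<bar> \<le> 1 / lo" using q lo_hi(1) unfolding abs_divide by (simp add: field_simps)
qed

text \<open>
  Around two points of the product with different second coordinates there are, at arbitrarily small
  scales \<open>\<rho>\<close>, disjoint cylinders \<open>(u, w)\<close> and \<open>(u', w')\<close> whose four slopes, signs included, are almost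
  equal, and comparable to \<open>\<rho>\<close> with constants that do not depend on \<open>\<rho>\<close>.

  Let \<open>U N\<close>, \<open>W N\<close> and \<open>U' N\<close>, \<open>W' N\<close> be prefixes of the addresses with slopes comparable to \<open>(1/2)^N\<close>.
  Along a subsequence the signed ratios of these slopes converge, so from some stage \<open>M\<close> on they are almost
  constant.  Appending to each word at stage \<open>N\<close> the word of the other point at the fixed stage \<open>M\<close>
  cancels the ratio, as slopes multiply commutatively; the words \<open>g\<close> and \<open>h\<close> then make the
  slopes in the two systems agree.
\<close>
lemma aligned_words:
  assumes pts: "x \<in> C1" "x' \<in> C1" "y \<in> C2" "y' \<in> C2" "y \<noteq> y'" and e: "0 < e"
  obtains K \<sigma> where "0 < K" "0 < \<sigma>"
    "\<And>\<rho>0. 0 < \<rho>0 \<Longrightarrow> \<exists>\<rho> u w u' w' k. 0 < \<rho> \<and> \<rho> < \<rho>0 \<and>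
       wordX u \<and> wordX u' \<and> wordY w \<and> wordY w' \<and>
       k \<le> length w \<and> k \<le> length w' \<and> take k w \<noteq> take k w' \<and>
       \<sigma> * \<rho> \<le> \<bar>X.slope u\<bar> \<and> \<bar>X.slope u\<bar> \<le> \<rho> \<and>
       \<bar>X.slope u' / X.slope u - 1\<bar> < e \<and>
       \<bar>Y.slope w / X.slope u - 1\<bar> < e \<and> \<bar>Y.slope w' / X.slope u' - 1\<bar> < e \<and>
       \<bar>X.act u 0 - x\<bar> \<le> K * \<rho> \<and> \<bar>X.act u' 0 - x'\<bar> \<le> K * \<rho> \<and>
       \<bar>Y.act w 0 - y\<bar> \<le> K * \<rho> \<and> \<bar>Y.act w' 0 - y'\<bar> \<le> K * \<rho>"
proof -
  obtain L1 where L1: "0 < L1" "\<And>x. x \<in> C1 \<Longrightarrow> \<bar>x\<bar> \<le> L1" using X.bound_exists by blast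
  obtain L2 where L2: "0 < L2" "\<And>x. x \<in> C2 \<Longrightarrow> \<bar>x\<bar> \<le> L2" using Y.bound_exists by blast
  obtain a z where a: "\<And>n. a n \<in> {1..A}" "\<And>n. z n \<in> C1" "\<And>n. x = X.act (map a [0..<n]) (z n)"
    by (rule X.address_exists[OF pts(1)]) (rule that)
  obtain a' z' where a': "\<And>n. a' n \<in> {1..A}" "\<And>n. z' n \<in> C1" "\<And>n. x' = X.act (map a' [0..<n]) (z' n)"
    by (rule X.address_exists[OF pts(2)]) (rule that)
  obtain j v where j: "\<And>n. j n \<in> {1..B}" "\<And>n. v n \<in> C2" "\<And>n. y = Y.act (map j [0..<n]) (v n)"
    by (rule Y.address_exists[OF pts(3)]) (rule that)
  obtain j' v' where j': "\<And>n. j' n \<in> {1..B}" "\<And>n. v' n \<in> C2" "\<And>n. y' = Y.act (map j' [0..<n]) (v' n)"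
    by (rule Y.address_exists[OF pts(4)]) (rule that)
  obtain k where k: "map j [0..<k] \<noteq> map j' [0..<k]"
    by (rule Y.addresses_differ[OF j(1) j(2) j(3) j'(2) j'(3) pts(5)])
  obtain h1 where h1: "\<And>N. \<bar>X.slope (map a [0..<h1 N])\<bar> \<le> (1/2) ^ N" "\<And>N. X.lo * (1/2) ^ N \<le> \<bar>X.slope (map a [0..<h1 N])\<bar>"
    by (rule X.prefixes_exist[OF a(1)]) (rule that)
  obtain h1' where h1': "\<And>N. \<bar>X.slope (map a' [0..<h1' N])\<bar> \<le> (1/2) ^ N" "\<And>N. X.lo * (1/2) ^ N \<le> \<bar>X.slope (map a' [0..<h1' N])\<bar>"
    by (rule X.prefixes_exist[OF a'(1)]) (rule that)
  obtain h2 where h2: "\<And>N. \<bar>Y.slope (map j [0..<h2 N])\<bar> \<le> (1/2) ^ N" "\<And>N. Y.lo * (1/2) ^ N \<le> \<bar>Y.slope (map j [0..<h2 N])\<bar>"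
    by (rule Y.prefixes_exist[OF j(1)]) (rule that)
  obtain h2' where h2': "\<And>N. \<bar>Y.slope (map j' [0..<h2' N])\<bar> \<le> (1/2) ^ N" "\<And>N. Y.lo * (1/2) ^ N \<le> \<bar>Y.slope (map j' [0..<h2' N])\<bar>"
    by (rule Y.prefixes_exist[OF j'(1)]) (rule that)
  define U where "U N = map a [0..<h1 N]" for N
  define U' where "U' N = map a' [0..<h1' N]" for N
  define W where "W N = map j [0..<h2 N]" for N
  define W' where "W' N = map j' [0..<h2' N]" for N
  have words: "wordX (U N)" "wordX (U' N)" "wordY (W N)" "wordY (W' N)" for N
    using a(1) a'(1) j(1) j'(1) unfolding U_def U'_def W_def W'_def by auto
  have small: "\<bar>X.slope (U N)\<bar> \<le> (1/2) ^ N" "\<bar>X.slope (U' N)\<bar> \<le> (1/2) ^ N"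
    "\<bar>Y.slope (W N)\<bar> \<le> (1/2) ^ N" "\<bar>Y.slope (W' N)\<bar> \<le> (1/2) ^ N" for N
    using h1(1) h1'(1) h2(1) h2'(1) unfolding U_def U'_def W_def W'_def by auto
  have "lo * (1/2) ^ N \<le> X.lo * (1/2) ^ N" "lo * (1/2) ^ N \<le> Y.lo * (1/2) ^ N" for N
    using lo_hi(5,6) by (intro mult_right_mono; simp)+
  then have large: "lo * (1/2) ^ N \<le> \<bar>X.slope (U N)\<bar>" "lo * (1/2) ^ N \<le> \<bar>X.slope (U' N)\<bar>"
    "lo * (1/2) ^ N \<le> \<bar>Y.slope (W N)\<bar>" "lo * (1/2) ^ N \<le> \<bar>Y.slope (W' N)\<bar>" for N
    using h1(2) h1'(2) h2(2) h2'(2) unfolding U_def U'_def W_def W'_def by (meson order.trans)+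
  have nz: "X.slope (U N) \<noteq> 0" "X.slope (U' N) \<noteq> 0" "Y.slope (W N) \<noteq> 0" "Y.slope (W' N) \<noteq> 0" for N
    using words X.slope_nonzero Y.slope_nonzero by auto
  have half: "0 < (1/2::real) ^ N" for N by simp
  define f1 where "f1 N = X.slope (U' N) / X.slope (U N)" for N
  define f2 where "f2 N = Y.slope (W' N) / Y.slope (W N)" for N
  define f3 where "f3 N = Y.slope (W N) / X.slope (U N)" for N
  have f: "lo \<le> \<bar>f1 N\<bar>" "\<bar>f1 N\<bar> \<le> 1 / lo" "lo \<le> \<bar>f2 N\<bar>" "\<bar>f2 N\<bar> \<le> 1 / lo" "lo \<le> \<bar>f3 N\<bar>" "\<bar>f3 N\<bar> \<le> 1 / lo" for N
    unfolding f1_def f2_def f3_def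
    using ratio_bounds[OF large(2) small(2) large(1) small(1) half]
      ratio_bounds[OF large(4) small(4) large(3) small(3) half]
      ratio_bounds[OF large(3) small(3) large(1) small(1) half] by blast+
  define e1 where "e1 = min (1/32) (e / 32)"
  have e1: "0 < e1" "32 * e1 \<le> 1" "32 * e1 \<le> e" using e unfolding e1_def by auto
  have f_in: "(f1 N, f2 N, f3 N) \<in> {-1/lo..1/lo} \<times> {-1/lo..1/lo} \<times> {-1/lo..1/lo}" for N
    using f[of N] by auto
  have "compact ({-1/lo..1/lo} \<times> {-1/lo..1/lo} \<times> {-1/lo..1/lo})" by (intro compact_Times) auto
  then have sc: "seq_compact ({-1/lo..1/lo} \<times> {-1/lo..1/lo} \<times> {-1/lo..1/lo})"
    by (rule compact_imp_seq_compact)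
  obtain p r where r: "strict_mono r" "((\<lambda>N. (f1 N, f2 N, f3 N)) \<circ> r) \<longlonglongrightarrow> p"
    by (rule seq_compactE[OF sc allI[OF f_in]]) (rule that)
  then have "convergent (\<lambda>n. (f1 (r n), f2 (r n), f3 (r n)))"
    unfolding convergent_def comp_def by blast
  then have "Cauchy (\<lambda>n. (f1 (r n), f2 (r n), f3 (r n)))" by (rule convergent_Cauchy)
  moreover have "0 < e1 * lo" using e1 lo_hi(1) by simp
  ultimately obtain M where M: "\<And>n. n \<ge> M \<Longrightarrow>
      dist (f1 (r n), f2 (r n), f3 (r n)) (f1 (r M), f2 (r M), f3 (r M)) < e1 * lo"
    unfolding Cauchy_def by (metis order.refl)
  define U0 where "U0 = U (r M)"
  define U0' where "U0' = U' (r M)"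
  define W0 where "W0 = W (r M)"
  define W0' where "W0' = W' (r M)"
  have q: "\<bar>f1 (r n) / f1 (r M) - 1\<bar> < e1" "\<bar>f2 (r n) / f2 (r M) - 1\<bar> < e1" "\<bar>f3 (r n) / f3 (r M) - 1\<bar> < e1"
    if "n \<ge> M" for n
  proof -
    let ?p = "(f1 (r n), f2 (r n), f3 (r n))" and ?q = "(f1 (r M), f2 (r M), f3 (r M))"
    have "\<bar>f1 (r n) - f1 (r M)\<bar> < e1 * lo" using dist_fst_le[of ?p ?q] M[OF that] by (simp add: dist_real_def)
    then show "\<bar>f1 (r n) / f1 (r M) - 1\<bar> < e1" using f lo_hi(1) e1(1) by (intro ratio_close) auto
    have "\<bar>f2 (r n) - f2 (r M)\<bar> < e1 * lo"
      using dist_fst_le[of "snd ?p" "snd ?q"] dist_snd_le[of ?p ?q] M[OF that] by (simp add: dist_real_def)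
    then show "\<bar>f2 (r n) / f2 (r M) - 1\<bar> < e1" using f lo_hi(1) e1(1) by (intro ratio_close) auto
    have "\<bar>f3 (r n) - f3 (r M)\<bar> < e1 * lo"
      using dist_snd_le[of "snd ?p" "snd ?q"] dist_snd_le[of ?p ?q] M[OF that] by (simp add: dist_real_def)
    then show "\<bar>f3 (r n) / f3 (r M) - 1\<bar> < e1" using f lo_hi(1) e1(1) by (intro ratio_close) auto
  qed
  have w0: "wordX (U0 @ U0')" "wordY (W0 @ W0')" using words unfolding U0_def U0'_def W0_def W0'_def by auto
  obtain g h where gh: "wordX g" "wordY h" "\<bar>Y.slope ((W0 @ W0') @ h) / X.slope ((U0 @ U0') @ g) - 1\<bar> < e1"
    by (rule return_words[OF w0 e1(1)])
  have nz0: "X.slope U0 \<noteq> 0" "X.slope U0' \<noteq> 0" "Y.slope W0 \<noteq> 0" "Y.slope W0' \<noteq> 0" "X.slope g \<noteq> 0" "Y.slope h \<noteq> 0"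
    using nz X.slope_nonzero[OF gh(1)] Y.slope_nonzero[OF gh(2)] unfolding U0_def U0'_def W0_def W0'_def by auto
  have tail: "wordX (U0' @ g)" "wordX (U0 @ g)" "wordY (W0' @ h)" "wordY (W0 @ h)" using w0 gh by auto
  define K where "K = \<bar>X.act (U0' @ g) 0\<bar> + \<bar>X.act (U0 @ g) 0\<bar> + \<bar>Y.act (W0' @ h) 0\<bar> + \<bar>Y.act (W0 @ h) 0\<bar> + L1 + L2"
  define \<sigma> where "\<sigma> = lo * \<bar>X.slope (U0' @ g)\<bar>"
  have main: "\<exists>\<rho> u w u' w' k. 0 < \<rho> \<and> \<rho> < \<rho>0 \<and>
       wordX u \<and> wordX u' \<and> wordY w \<and> wordY w' \<and>
       k \<le> length w \<and> k \<le> length w' \<and> take k w \<noteq> take k w' \<and>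
       \<sigma> * \<rho> \<le> \<bar>X.slope u\<bar> \<and> \<bar>X.slope u\<bar> \<le> \<rho> \<and>
       \<bar>X.slope u' / X.slope u - 1\<bar> < e \<and>
       \<bar>Y.slope w / X.slope u - 1\<bar> < e \<and> \<bar>Y.slope w' / X.slope u' - 1\<bar> < e \<and>
       \<bar>X.act u 0 - x\<bar> \<le> K * \<rho> \<and> \<bar>X.act u' 0 - x'\<bar> \<le> K * \<rho> \<and>
       \<bar>Y.act w 0 - y\<bar> \<le> K * \<rho> \<and> \<bar>Y.act w' 0 - y'\<bar> \<le> K * \<rho>" if \<rho>0: "0 < \<rho>0" for \<rho>0
  proof -
    have "0 < min \<rho>0 (Y.lo ^ k)" using \<rho>0 Y.lo_hi(1) by simp
    then obtain N0 where N0: "(1/2) ^ N0 < min \<rho>0 (Y.lo ^ k)" using real_arch_pow_inv[of "min \<rho>0 (Y.lo ^ k)" "1/2"] by auto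
    define n where "n = max M N0"
    define N where "N = r n"
    have "N0 \<le> N" using seq_suble[OF r(1), of n] unfolding N_def n_def by simp
    then have "(1/2::real) ^ N \<le> (1/2) ^ N0" by (intro power_decreasing) auto
    with N0 have N: "(1/2) ^ N < \<rho>0" "(1/2) ^ N < Y.lo ^ k" unfolding min_less_iff_conj by linarith+
    have qn: "\<bar>f1 N / f1 (r M) - 1\<bar> < e1" "\<bar>f2 N / f2 (r M) - 1\<bar> < e1" "\<bar>f3 N / f3 (r M) - 1\<bar> < e1"
      using q[of n] unfolding N_def n_def by auto
    define u where "u = U N @ (U0' @ g)"
    define u' where "u' = U' N @ (U0 @ g)"
    define w where "w = W N @ (W0' @ h)"
    define w' where "w' = W' N @ (W0 @ h)"
    define q4 where "q4 = Y.slope ((W0 @ W0') @ h) / X.slope ((U0 @ U0') @ g)"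
    \<comment> \<open>beyond length \<open>k\<close> the addresses of \<open>y\<close> and \<open>y'\<close> have separated\<close>
    have long: "k < h2 N" "k < h2' N"
    proof -
      have "Y.lo ^ h2 N < Y.lo ^ k"
        using Y.slope_bounds(1)[OF words(3), of N] small(3)[of N] N(2) unfolding W_def by simp
      then show "k < h2 N" using Y.lo_hi(1,6) by (metis not_less power_decreasing less_imp_le)
      have "Y.lo ^ h2' N < Y.lo ^ k"
        using Y.slope_bounds(1)[OF words(4), of N] small(4)[of N] N(2) unfolding W'_def by simp
      then show "k < h2' N" using Y.lo_hi(1,6) by (metis not_less power_decreasing less_imp_le)
    qed
    have "take k w = map j [0..<k]" "take k w' = map j' [0..<k]"
      using long unfolding w_def w'_def W_def W'_def by (simp_all add: take_map)
    then have "take k w \<noteq> take k w'" using k by simp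
    moreover have "k \<le> length w" "k \<le> length w'" using long unfolding w_def w'_def W_def W'_def by simp_all
    moreover have "wordX u" "wordX u'" "wordY w" "wordY w'"
      using words tail unfolding u_def u'_def w_def w'_def by auto
    moreover have "\<sigma> * (1/2) ^ N \<le> \<bar>X.slope u\<bar>"
    proof -
      have "lo * (1/2) ^ N * \<bar>X.slope (U0' @ g)\<bar> \<le> \<bar>X.slope (U N)\<bar> * \<bar>X.slope (U0' @ g)\<bar>"
        using large(1) by (intro mult_right_mono) auto
      then show ?thesis unfolding u_def X.slope_append[of "U N"] \<sigma>_def abs_mult by (simp only: mult_ac)
    qed
    moreover have "\<bar>X.slope u\<bar> \<le> (1/2) ^ N"
    proof -
      have "\<bar>X.slope (U N)\<bar> * \<bar>X.slope (U0' @ g)\<bar> \<le> (1/2) ^ N * 1"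
        using small(1) X.slope_le_1[OF tail(1)] by (intro mult_mono) auto
      then show ?thesis unfolding u_def X.slope_append[of "U N"] abs_mult by simp
    qed
    moreover have r1: "X.slope u' / X.slope u = f1 N / f1 (r M)"
      unfolding u_def u'_def f1_def U0_def U0'_def using nz X.slope_nonzero[OF gh(1)] by (simp add: field_simps)
    then have "\<bar>X.slope u' / X.slope u - 1\<bar> < e" using qn(1) e1 by simp
    moreover have r3: "Y.slope w / X.slope u = (f3 N / f3 (r M)) * q4"
      unfolding u_def w_def f3_def q4_def U0_def U0'_def W0_def W0'_def
      using nz X.slope_nonzero[OF gh(1)] Y.slope_nonzero[OF gh(2)] by (simp add: field_simps)
    have c3: "\<bar>Y.slope w / X.slope u - 1\<bar> < 3 * e1"
      using product_close[OF qn(3) gh(3)[folded q4_def]] e1 unfolding r3 by simp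
    then have "\<bar>Y.slope w / X.slope u - 1\<bar> < e" using e1 by linarith
    moreover have "\<bar>Y.slope w' / X.slope u' - 1\<bar> < e"
    proof -
      have r4: "Y.slope w' / X.slope u' = (Y.slope w / X.slope u) * ((f2 N / f2 (r M)) * (1 / (f1 N / f1 (r M))))"
        unfolding u_def w_def u'_def w'_def f1_def f2_def U0_def U0'_def W0_def W0'_def
        using nz X.slope_nonzero[OF gh(1)] Y.slope_nonzero[OF gh(2)] by (simp add: field_simps)
      have c2: "\<bar>(f2 N / f2 (r M)) * (1 / (f1 N / f1 (r M))) - 1\<bar> < e1 + 2 * (2 * e1)"
        using e1 by (intro product_close qn inverse_close) auto
      have "\<bar>Y.slope w' / X.slope u' - 1\<bar> < 3 * e1 + 2 * (e1 + 2 * (2 * e1))"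
        unfolding r4 by (rule product_close[OF c3 c2]) (use e1 in simp)
      also have "\<dots> \<le> e" using e1 by simp
      finally show ?thesis .
    qed
    moreover have "\<bar>X.act u 0 - x\<bar> \<le> K * (1/2) ^ N" "\<bar>X.act u' 0 - x'\<bar> \<le> K * (1/2) ^ N"
      "\<bar>Y.act w 0 - y\<bar> \<le> K * (1/2) ^ N" "\<bar>Y.act w' 0 - y'\<bar> \<le> K * (1/2) ^ N"
    proof -
      have "\<bar>X.act u 0 - x\<bar> \<le> (\<bar>X.act (U0' @ g) 0\<bar> + L1) * (1/2) ^ N"
        unfolding u_def U_def by (rule X.act_prefix_bound[OF a(3) a(2) L1(2) h1(1)])
      also have "\<dots> \<le> K * (1/2) ^ N" using L1 L2 unfolding K_def by (intro mult_right_mono) auto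
      finally show "\<bar>X.act u 0 - x\<bar> \<le> K * (1/2) ^ N" .
      have "\<bar>X.act u' 0 - x'\<bar> \<le> (\<bar>X.act (U0 @ g) 0\<bar> + L1) * (1/2) ^ N"
        unfolding u'_def U'_def by (rule X.act_prefix_bound[OF a'(3) a'(2) L1(2) h1'(1)])
      also have "\<dots> \<le> K * (1/2) ^ N" using L1 L2 unfolding K_def by (intro mult_right_mono) auto
      finally show "\<bar>X.act u' 0 - x'\<bar> \<le> K * (1/2) ^ N" .
      have "\<bar>Y.act w 0 - y\<bar> \<le> (\<bar>Y.act (W0' @ h) 0\<bar> + L2) * (1/2) ^ N"
        unfolding w_def W_def by (rule Y.act_prefix_bound[OF j(3) j(2) L2(2) h2(1)])
      also have "\<dots> \<le> K * (1/2) ^ N" using L1 L2 unfolding K_def by (intro mult_right_mono) auto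
      finally show "\<bar>Y.act w 0 - y\<bar> \<le> K * (1/2) ^ N" .
      have "\<bar>Y.act w' 0 - y'\<bar> \<le> (\<bar>Y.act (W0 @ h) 0\<bar> + L2) * (1/2) ^ N"
        unfolding w'_def W'_def by (rule Y.act_prefix_bound[OF j'(3) j'(2) L2(2) h2'(1)])
      also have "\<dots> \<le> K * (1/2) ^ N" using L1 L2 unfolding K_def by (intro mult_right_mono) auto
      finally show "\<bar>Y.act w' 0 - y'\<bar> \<le> K * (1/2) ^ N" .
    qed
    moreover note half[of N] N(1)
    ultimately show ?thesis by (intro exI conjI)
  qed
  show ?thesis
  proof (rule that[OF _ _ main])
    show "0 < K" using L1 L2 unfolding K_def by simp
    show "0 < \<sigma>" using lo_hi(1) X.slope_pos[OF tail(1)] unfolding \<sigma>_def by simp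
  qed
qed

section \<open>Clusters improve on a porous complement\<close>

text \<open>
  The copy of a cluster inside the cylinder \<open>(u, w)\<close>, refined to words of prescribed lengths.
\<close>
lemma cluster_copy:
  assumes Q: "Q \<subseteq> X.words m \<times> Y.words n"
    and near: "\<And>p q. (p, q) \<in> Q \<Longrightarrow> cell (t * (Y.slope w / X.slope u)) p q \<subseteq> cball c l"
    and uw: "wordX u" "wordY w" and len: "length u + m \<le> m'" "length w + n \<le> n'"
  obtains R where "R \<subseteq> X.words m' \<times> Y.words n'" "mass R = X.weight u * Y.weight w * mass Q"
    "\<And>p q. (p, q) \<in> R \<Longrightarrow> take (length w) q = w"
    "\<And>p q. (p, q) \<in> R \<Longrightarrow>
      cell t p q \<subseteq> cball (X.act u 0 + t * Y.act w 0 + X.slope u * c) (\<bar>X.slope u\<bar> * l)"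
proof -
  define P where "P = (\<lambda>(p, q). (u @ p, w @ q)) ` Q"
  define i where "i = m' - (length u + m)"
  define j where "j = n' - (length w + n)"
  define R where "R = (\<lambda>((p, q), (e, f)). (p @ e, q @ f)) ` (P \<times> (X.words i \<times> Y.words j))"
  have u: "u \<in> X.words (length u)" and w: "w \<in> Y.words (length w)"
    using uw unfolding X.words_def Y.words_def by auto
  have P: "P \<subseteq> X.words (length u + m) \<times> Y.words (length w + n)"
    using Q X.words_append[OF u] Y.words_append[OF w] unfolding P_def by auto
  have ij: "m' = length u + m + i" "n' = length w + n + j" using len unfolding i_def j_def by auto
  have R_cases: "\<exists>p0 q0 e f. (p0, q0) \<in> Q \<and> e \<in> X.words i \<and> f \<in> Y.words j \<and> p = (u @ p0) @ e \<and> q = (w @ q0) @ f"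
    if "(p, q) \<in> R" for p q
  proof -
    obtain p0 q0 e f where "(p0, q0) \<in> Q" "e \<in> X.words i" "f \<in> Y.words j"
      "p = (u @ p0) @ e" "q = (w @ q0) @ f"
      using \<open>(p, q) \<in> R\<close> unfolding R_def P_def by auto
    then show ?thesis by blast
  qed
  show ?thesis
  proof (rule that[of R])
    show "R \<subseteq> X.words m' \<times> Y.words n'"
    proof clarify
      fix p q assume "(p, q) \<in> R"
      then obtain p0 q0 e f where pq: "(p0, q0) \<in> Q" "e \<in> X.words i" "f \<in> Y.words j"
        "p = (u @ p0) @ e" "q = (w @ q0) @ f"
        using R_cases by blast
      have "(u @ p0, w @ q0) \<in> X.words (length u + m) \<times> Y.words (length w + n)"
        using P pq(1) unfolding P_def by auto
      then show "p \<in> X.words m' \<and> q \<in> Y.words n'"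
        unfolding pq(4,5) ij using X.words_append Y.words_append pq(2,3) by blast
    qed
    show "mass R = X.weight u * Y.weight w * mass Q"
      unfolding R_def mass_refine[OF P] unfolding P_def by (rule mass_append)
    show "take (length w) q = w" if "(p, q) \<in> R" for p q
      using R_cases[OF that] by auto
    show "cell t p q \<subseteq> cball (X.act u 0 + t * Y.act w 0 + X.slope u * c) (\<bar>X.slope u\<bar> * l)"
      if pq_in: "(p, q) \<in> R" for p q
    proof -
      obtain p0 q0 e f where pq: "(p0, q0) \<in> Q" "e \<in> X.words i" "f \<in> Y.words j"
        "p = (u @ p0) @ e" "q = (w @ q0) @ f"
        using R_cases[OF pq_in] by blast
      have "cell t p q \<subseteq> cell t (u @ p0) (w @ q0)"
        unfolding pq(4,5) using pq(2,3) by (intro cell_append_subset) (auto simp: X.words_def Y.words_def)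
      also have "\<dots> \<subseteq> cball (X.act u 0 + t * Y.act w 0 + X.slope u * c) (\<bar>X.slope u\<bar> * l)"
        by (rule cell_append_cball[OF uw(1) near[OF pq(1)]])
      finally show ?thesis .
    qed
  qed
qed

lemma weight_lower_bound:
  assumes "0 \<le> a" "a \<le> \<bar>X.slope u\<bar>" "a \<le> \<bar>Y.slope w\<bar>"
  shows "a powr (d1 + d2) \<le> X.weight u * Y.weight w"
  unfolding powr_add X.weight_def Y.weight_def
  using assms X.dim_nonneg Y.dim_nonneg by (intro mult_mono powr_mono2) auto

text \<open>
  Two disjoint cylinders of almost equal slopes both contain a copy of a cluster.  At a parameter \<open>t\<close> where
  the two copies project almost onto the same interval, the weight has doubled and the cost has hardly
  changed.  In the limit \<open>\<epsilon>\<close> would drop to \<open>\<epsilon> / 2\<close>; the factor \<open>2 / 3\<close> leaves room for the errors.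
\<close>
lemma clustered_double:
  assumes Q: "Q \<subseteq> X.words m \<times> Y.words n" and l: "0 < l" and \<epsilon>: "0 < \<epsilon>"
    and near: "\<And>t' p q. \<bar>t' - t0\<bar> \<le> \<eta> \<Longrightarrow> (p, q) \<in> Q \<Longrightarrow> cell t' p q \<subseteq> cball c l"
    and words: "wordX u" "wordX u'" "wordY w" "wordY w'"
    and split: "k \<le> length w" "k \<le> length w'" "take k w \<noteq> take k w'"
    and t: "\<bar>t * (Y.slope w / X.slope u) - t0\<bar> \<le> \<eta>" "\<bar>t * (Y.slope w' / X.slope u') - t0\<bar> \<le> \<eta>"
    and e: "0 < e" "e < 1" and ratios: "\<bar>X.slope u' / X.slope u - 1\<bar> < e"
      "\<bar>Y.slope w / X.slope u - 1\<bar> < e" "\<bar>Y.slope w' / X.slope u' - 1\<bar> < e"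
    and aligned: "\<bar>(X.act u 0 + t * Y.act w 0 + X.slope u * c) - (X.act u' 0 + t * Y.act w' 0 + X.slope u' * c)\<bar>
      \<le> e * \<bar>X.slope u\<bar>"
    and cost: "(2 * ((1 + e) * l + e)) powr (d1 + d2) < 4 / 3 * \<epsilon> * ((1 - e) ^ 2) powr (d1 + d2) * mass Q"
  shows "clustered (2 / 3 * \<epsilon>) t"
proof -
  let ?A = "X.act u 0 + t * Y.act w 0 + X.slope u * c"
  let ?A' = "X.act u' 0 + t * Y.act w' 0 + X.slope u' * c"
  let ?\<alpha> = "\<bar>X.slope u\<bar>"
  define m' where "m' = max (length u) (length u') + m"
  define n' where "n' = max (length w) (length w') + n"
  obtain R where R: "R \<subseteq> X.words m' \<times> Y.words n'" "mass R = X.weight u * Y.weight w * mass Q"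
    "\<And>p q. (p, q) \<in> R \<Longrightarrow> take (length w) q = w"
    "\<And>p q. (p, q) \<in> R \<Longrightarrow> cell t p q \<subseteq> cball ?A (?\<alpha> * l)"
    by (rule cluster_copy[OF Q near[OF t(1)] words(1,3), of m' n']) (auto simp: m'_def n'_def)
  obtain R' where R': "R' \<subseteq> X.words m' \<times> Y.words n'" "mass R' = X.weight u' * Y.weight w' * mass Q"
    "\<And>p q. (p, q) \<in> R' \<Longrightarrow> take (length w') q = w'"
    "\<And>p q. (p, q) \<in> R' \<Longrightarrow> cell t p q \<subseteq> cball ?A' (\<bar>X.slope u'\<bar> * l)"
    by (rule cluster_copy[OF Q near[OF t(2)] words(2,4), of m' n']) (auto simp: m'_def n'_def)
  have "R \<inter> R' = {}"
  proof (rule ccontr)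
    assume "R \<inter> R' \<noteq> {}"
    then obtain p q where "(p, q) \<in> R" "(p, q) \<in> R'" by auto
    then have "take (length w) q = w" "take (length w') q = w'" using R(3) R'(3) by auto
    then have "take k w = take k q" "take k w' = take k q"
      using split(1,2) by (metis min.absorb1 take_take)+
    then show False using split(3) by simp
  qed
  moreover have "finite R" "finite R'" using R(1) R'(1) finite_words_times finite_subset by blast+
  ultimately have mass: "mass (R \<union> R') = (X.weight u * Y.weight w + X.weight u' * Y.weight w') * mass Q"
    using R(2) R'(2) unfolding mass_def by (simp add: sum.union_disjoint distrib_right)
  have \<alpha>: "0 < ?\<alpha>" "0 < \<bar>X.slope u'\<bar>" using X.slope_pos words by auto
  have b: "\<bar>X.slope u'\<bar> \<le> (1 + e) * ?\<alpha>" "(1 - e) * ?\<alpha> \<le> \<bar>X.slope u'\<bar>"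
    "(1 - e) * ?\<alpha> \<le> \<bar>Y.slope w\<bar>" "(1 - e) * \<bar>X.slope u'\<bar> \<le> \<bar>Y.slope w'\<bar>"
  proof -
    have "\<bar>X.slope u' / X.slope u\<bar> \<le> 1 + e" "1 - e \<le> \<bar>X.slope u' / X.slope u\<bar>"
      "1 - e \<le> \<bar>Y.slope w / X.slope u\<bar>" "1 - e \<le> \<bar>Y.slope w' / X.slope u'\<bar>"
      using ratios by linarith+
    then show "\<bar>X.slope u'\<bar> \<le> (1 + e) * ?\<alpha>" "(1 - e) * ?\<alpha> \<le> \<bar>X.slope u'\<bar>"
      "(1 - e) * ?\<alpha> \<le> \<bar>Y.slope w\<bar>" "(1 - e) * \<bar>X.slope u'\<bar> \<le> \<bar>Y.slope w'\<bar>"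
      using \<alpha> unfolding abs_divide by (simp_all add: pos_divide_le_eq pos_le_divide_eq)
  qed
  define a where "a = (1 - e) ^ 2 * ?\<alpha>"
  have a1: "a \<le> (1 - e) * ?\<alpha>"
    unfolding a_def power2_eq_square using e \<alpha> by (intro mult_right_mono) (auto simp: mult_le_cancel_left1)
  have a2: "a \<le> (1 - e) * \<bar>X.slope u'\<bar>"
    unfolding a_def power2_eq_square mult.assoc using b(2) e by (intro mult_left_mono) auto
  have a0: "0 \<le> a" unfolding a_def by simp
  have "(1 - e) * ?\<alpha> \<le> 1 * ?\<alpha>" using e \<alpha> by (intro mult_right_mono) auto
  then have "a \<le> ?\<alpha>" using a1 by linarith
  then have w1: "a powr (d1 + d2) \<le> X.weight u * Y.weight w"
    using a0 a1 b by (intro weight_lower_bound) auto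
  have w2: "a powr (d1 + d2) \<le> X.weight u' * Y.weight w'"
    using a0 a1 a2 b by (intro weight_lower_bound) auto
  define l' where "l' = ?\<alpha> * ((1 + e) * l + e)"
  have l1: "?\<alpha> * l \<le> l'" unfolding l'_def using l e \<alpha> by (intro mult_left_mono) (auto simp: algebra_simps)
  have l2: "\<bar>X.slope u'\<bar> * l + \<bar>?A - ?A'\<bar> \<le> l'"
  proof -
    have "\<bar>X.slope u'\<bar> * l \<le> (1 + e) * ?\<alpha> * l" using b(1) l by (intro mult_right_mono) auto
    then have "\<bar>X.slope u'\<bar> * l + \<bar>?A - ?A'\<bar> \<le> (1 + e) * ?\<alpha> * l + e * ?\<alpha>" using aligned by linarith
    also have "\<dots> = l'" unfolding l'_def by (simp add: algebra_simps)
    finally show ?thesis .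
  qed
  show ?thesis
    unfolding clustered_def
  proof (intro exI conjI)
    show "R \<union> R' \<subseteq> X.words m' \<times> Y.words n'" using R(1) R'(1) by blast
    show "0 < l'" unfolding l'_def using l e \<alpha> by (intro mult_pos_pos add_pos_pos) auto
    show "\<forall>(p, q)\<in>R \<union> R'. cell t p q \<subseteq> cball ?A l'"
    proof clarify
      fix p q z assume pq: "(p, q) \<in> R \<union> R'" and z: "z \<in> cell t p q"
      show "z \<in> cball ?A l'"
      proof (cases "(p, q) \<in> R")
        case True
        then have "z \<in> cball ?A (?\<alpha> * l)" using R(4) z by blast
        then show ?thesis using l1 by simp
      next
        case False
        then have "z \<in> cball ?A' (\<bar>X.slope u'\<bar> * l)" using R'(4) z pq by blast
        then show ?thesis using l2 dist_triangle[of ?A z ?A'] by (simp add: dist_real_def)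
      qed
    qed
    have "(2 * l') powr (d1 + d2) = ?\<alpha> powr (d1 + d2) * (2 * ((1 + e) * l + e)) powr (d1 + d2)"
    proof -
      have "2 * l' = ?\<alpha> * (2 * ((1 + e) * l + e))" unfolding l'_def by simp
      then show ?thesis using l e by (simp only: powr_mult)
    qed
    also have "\<dots> < ?\<alpha> powr (d1 + d2) * (4 / 3 * \<epsilon> * ((1 - e) ^ 2) powr (d1 + d2) * mass Q)"
      using cost \<alpha> by (intro mult_strict_left_mono) auto
    also have "\<dots> = 2 / 3 * \<epsilon> * ((a powr (d1 + d2) + a powr (d1 + d2)) * mass Q)"
      unfolding a_def by (simp add: powr_mult)
    also have "\<dots> \<le> 2 / 3 * \<epsilon> * mass (R \<union> R')"
      unfolding mass using w1 w2 \<epsilon> mass_nonneg by (intro mult_left_mono mult_right_mono add_mono) auto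
    finally show "(2 * l') powr (d1 + d2) < 2 / 3 * \<epsilon> * mass (R \<union> R')" .
  qed
qed

text \<open>
  Near a clustered parameter \<open>t0\<close> at which two points of the product have the same projection, the better
  clustered parameters fill a fixed proportion of arbitrarily small intervals.  The projections of the
  two cylinders of size \<open>\<rho>\<close> are within \<open>O(\<rho>)\<close> of each other at \<open>t0\<close> and move against each other with speed
  \<open>D\<close>, which is about \<open>y - y'\<close>; so they coincide at some \<open>ts\<close> within \<open>O(\<rho>)\<close> of \<open>t0\<close>, and remain aligned on an
  interval of radius \<open>\<zeta> * \<rho>\<close>.
\<close>
lemma clustered_porous:
  assumes cl: "clustered \<epsilon> t0" and \<epsilon>: "0 < \<epsilon>"
    and pts: "x \<in> C1" "x' \<in> C1" "y \<in> C2" "y' \<in> C2" "y \<noteq> y'" and eq: "x + t0 * y = x' + t0 * y'"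
  shows "\<exists>k>0. \<forall>d>0. \<exists>r c. 0 < r \<and> r < d \<and> ball c (k * r) \<subseteq> ball t0 r \<and>
    (\<forall>t\<in>ball c (k * r). clustered (2 / 3 * \<epsilon>) t)"
proof -
  obtain m n Q c l0 where Q: "Q \<subseteq> X.words m \<times> Y.words n" "\<forall>(u, w)\<in>Q. cell t0 u w \<subseteq> cball c l0"
    and l0: "0 < l0" "(2 * l0) powr (d1 + d2) < \<epsilon> * mass Q"
    using cl unfolding clustered_def by blast
  obtain l \<eta> where l: "0 < l" "0 < \<eta>" "(2 * l) powr (d1 + d2) < \<epsilon> * mass Q"
    "\<And>t' u w. \<bar>t' - t0\<bar> \<le> \<eta> \<Longrightarrow> (u, w) \<in> Q \<Longrightarrow> cell t' u w \<subseteq> cball c l"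
    by (rule cluster_robust[OF Q(2,1) l0]) (rule that)
  \<comment> \<open>the requirement of \<open>clustered_double\<close> on the tolerance \<open>e\<close> holds strictly in the limit \<open>e = 0\<close>\<close>
  define \<phi> where "\<phi> e = (2 * ((1 + e) * l + e)) powr (d1 + d2) - 4 / 3 * \<epsilon> * ((1 - e) ^ 2) powr (d1 + d2) * mass Q" for e
  have "isCont \<phi> 0" unfolding \<phi>_def using l(1) by (intro continuous_intros) auto
  moreover have "\<phi> 0 < 0"
  proof -
    have "0 < \<epsilon> * mass Q" using l(3) by (meson le_less_trans powr_ge_zero)
    then show ?thesis using l(3) unfolding \<phi>_def by simp
  qed
  ultimately have "\<forall>\<^sub>F e in at 0. \<phi> e < 0" unfolding isCont_def by (metis order_tendstoD(2))
  then obtain e0 where e0: "0 < e0" "\<And>e. e \<noteq> 0 \<Longrightarrow> dist e 0 < e0 \<Longrightarrow> \<phi> e < 0"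
    unfolding eventually_at by auto
  define e where "e = min (min (e0 / 2) (1 / 2)) (\<eta> / (2 * (1 + \<bar>t0\<bar>)))"
  have e: "0 < e" "e < 1" "e < e0" using e0(1) l(2) unfolding e_def by auto
  have et: "\<bar>t0\<bar> * e \<le> \<eta> / 2"
  proof -
    have "e \<le> \<eta> / (2 * (1 + \<bar>t0\<bar>))" unfolding e_def by simp
    then have "e * (2 * (1 + \<bar>t0\<bar>)) \<le> \<eta>" by (subst (asm) pos_le_divide_eq) auto
    then show ?thesis using e(1) by (simp add: algebra_simps)
  qed
  have "\<phi> e < 0" using e by (intro e0(2)) auto
  then have cost: "(2 * ((1 + e) * l + e)) powr (d1 + d2) < 4 / 3 * \<epsilon> * ((1 - e) ^ 2) powr (d1 + d2) * mass Q"
    unfolding \<phi>_def by simp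
  obtain K \<sigma> where K: "0 < K" "0 < \<sigma>" and al:
    "\<And>\<rho>0. 0 < \<rho>0 \<Longrightarrow> \<exists>\<rho> u w u' w' k. 0 < \<rho> \<and> \<rho> < \<rho>0 \<and>
       wordX u \<and> wordX u' \<and> wordY w \<and> wordY w' \<and>
       k \<le> length w \<and> k \<le> length w' \<and> take k w \<noteq> take k w' \<and>
       \<sigma> * \<rho> \<le> \<bar>X.slope u\<bar> \<and> \<bar>X.slope u\<bar> \<le> \<rho> \<and>
       \<bar>X.slope u' / X.slope u - 1\<bar> < e \<and>
       \<bar>Y.slope w / X.slope u - 1\<bar> < e \<and> \<bar>Y.slope w' / X.slope u' - 1\<bar> < e \<and>
       \<bar>X.act u 0 - x\<bar> \<le> K * \<rho> \<and> \<bar>X.act u' 0 - x'\<bar> \<le> K * \<rho> \<and>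
       \<bar>Y.act w 0 - y\<bar> \<le> K * \<rho> \<and> \<bar>Y.act w' 0 - y'\<bar> \<le> K * \<rho>"
    by (rule aligned_words[OF pts e(1)]) (rule that)
  define \<Delta> where "\<Delta> = \<bar>y - y'\<bar>"
  have \<Delta>: "0 < \<Delta>" using pts(5) unfolding \<Delta>_def by simp
  define H where "H = 2 * K * (1 + \<bar>t0\<bar>) + \<bar>c\<bar>"
  have H: "0 < H" unfolding H_def using K(1) by (intro add_pos_nonneg mult_pos_pos) auto
  define \<zeta> where "\<zeta> = 2 * e * \<sigma> / (3 * \<Delta>)"
  have \<zeta>: "0 < \<zeta>" "3 / 2 * \<Delta> * \<zeta> = e * \<sigma>" using e(1) K(2) \<Delta> unfolding \<zeta>_def by (auto simp: field_simps)
  define G where "G = 2 * H / \<Delta> + \<zeta>"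
  have G: "0 < G" using H \<Delta> \<zeta>(1) unfolding G_def by (intro add_pos_pos divide_pos_pos) auto
  show ?thesis
  proof (rule exI[of _ "\<zeta> / G"], intro conjI allI impI)
    show "0 < \<zeta> / G" using \<zeta>(1) G by simp
    fix d :: real assume d: "0 < d"
    define \<rho>0 where "\<rho>0 = min (min d (\<eta> / 4) / G) (\<Delta> / (4 * K))"
    have "0 < \<rho>0" using d l(2) G \<Delta> K(1) unfolding \<rho>0_def by simp
    from al[OF this] obtain \<rho> u w u' w' k where \<rho>: "0 < \<rho>" "\<rho> < \<rho>0"
      and words: "wordX u" "wordX u'" "wordY w" "wordY w'"
      and split: "k \<le> length w" "k \<le> length w'" "take k w \<noteq> take k w'"
      and su: "\<sigma> * \<rho> \<le> \<bar>X.slope u\<bar>" "\<bar>X.slope u\<bar> \<le> \<rho>"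
      and ratios: "\<bar>X.slope u' / X.slope u - 1\<bar> < e"
        "\<bar>Y.slope w / X.slope u - 1\<bar> < e" "\<bar>Y.slope w' / X.slope u' - 1\<bar> < e"
      and near: "\<bar>X.act u 0 - x\<bar> \<le> K * \<rho>" "\<bar>X.act u' 0 - x'\<bar> \<le> K * \<rho>"
        "\<bar>Y.act w 0 - y\<bar> \<le> K * \<rho>" "\<bar>Y.act w' 0 - y'\<bar> \<le> K * \<rho>"
      by blast
    have \<rho>G: "\<rho> * G < min d (\<eta> / 4)" and \<rho>K: "2 * (K * \<rho>) \<le> \<Delta> / 2"
    proof -
      have "\<rho> < min d (\<eta> / 4) / G" using \<rho>(2) unfolding \<rho>0_def by simp
      then show "\<rho> * G < min d (\<eta> / 4)" using G by (simp only: pos_less_divide_eq)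
      have "\<rho> < \<Delta> / (4 * K)" using \<rho>(2) unfolding \<rho>0_def by simp
      then show "2 * (K * \<rho>) \<le> \<Delta> / 2" using K(1) by (simp add: pos_less_divide_eq algebra_simps)
    qed
    \<comment> \<open>the distance between the two copies at the parameter \<open>t\<close> is \<open>\<bar>D0 + t * D\<bar>\<close>\<close>
    define D where "D = Y.act w 0 - Y.act w' 0"
    define D0 where "D0 = X.act u 0 - X.act u' 0 + (X.slope u - X.slope u') * c"
    have D: "\<Delta> / 2 \<le> \<bar>D\<bar>" "\<bar>D\<bar> \<le> 3 / 2 * \<Delta>"
    proof -
      have "\<bar>D - (y - y')\<bar> \<le> 2 * (K * \<rho>)" using near(3,4) unfolding D_def by linarith
      then have "\<bar>D - (y - y')\<bar> \<le> \<Delta> / 2" using \<rho>K by linarith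
      moreover have "\<Delta> - \<bar>D\<bar> \<le> \<bar>D - (y - y')\<bar>" "\<bar>D\<bar> - \<Delta> \<le> \<bar>D - (y - y')\<bar>"
        unfolding \<Delta>_def by (rule abs_triangle_ineq2_sym abs_triangle_ineq2)+
      ultimately show "\<Delta> / 2 \<le> \<bar>D\<bar>" "\<bar>D\<bar> \<le> 3 / 2 * \<Delta>" by linarith+
    qed
    have D00: "\<bar>D0 + t0 * D\<bar> \<le> H * \<rho>"
    proof -
      have "\<bar>X.slope u - X.slope u'\<bar> \<le> \<rho>"
      proof -
        have "X.slope u \<noteq> 0" using X.slope_nonzero words by auto
        then have "\<bar>X.slope u - X.slope u'\<bar> = \<bar>X.slope u' / X.slope u - 1\<bar> * \<bar>X.slope u\<bar>"
          by (simp add: abs_mult[symmetric] left_diff_distrib abs_minus_commute)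
        also have "\<dots> \<le> 1 * \<rho>" using ratios(1) e(2) su(2) by (intro mult_mono) auto
        finally show ?thesis by simp
      qed
      then have h1: "\<bar>(X.slope u - X.slope u') * c\<bar> \<le> \<rho> * \<bar>c\<bar>" unfolding abs_mult by (rule mult_right_mono) simp
      have h2: "\<bar>t0 * ((Y.act w 0 - y) - (Y.act w' 0 - y'))\<bar> \<le> \<bar>t0\<bar> * (2 * (K * \<rho>))"
        unfolding abs_mult using near(3,4) by (intro mult_left_mono) linarith+
      have "D0 + t0 * D = (X.act u 0 - x) - (X.act u' 0 - x') + t0 * ((Y.act w 0 - y) - (Y.act w' 0 - y'))
          + (X.slope u - X.slope u') * c + ((x + t0 * y) - (x' + t0 * y'))"
        unfolding D0_def D_def by (simp add: algebra_simps)
      then have "\<bar>D0 + t0 * D\<bar> \<le> 2 * (K * \<rho>) + \<bar>t0\<bar> * (2 * (K * \<rho>)) + \<rho> * \<bar>c\<bar>"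
        using near(1,2) h1 h2 eq by linarith
      also have "\<dots> = H * \<rho>" unfolding H_def by (simp add: algebra_simps)
      finally show ?thesis .
    qed
    define ts where "ts = t0 - (D0 + t0 * D) / D"
    have "D \<noteq> 0" using D(1) \<Delta> by auto
    then have ts: "D0 + ts * D = 0" unfolding ts_def left_diff_distrib by simp
    have tst0: "\<bar>ts - t0\<bar> \<le> 2 * H / \<Delta> * \<rho>"
    proof -
      have "\<bar>ts - t0\<bar> = \<bar>D0 + t0 * D\<bar> / \<bar>D\<bar>" unfolding ts_def by (simp add: abs_divide)
      also have "\<dots> \<le> (H * \<rho>) / (\<Delta> / 2)" using D00 D(1) \<Delta> H \<rho>(1) by (intro frac_le) auto
      finally show ?thesis by (simp add: field_simps)
    qed
    define r where "r = \<rho> * G"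
    have r: "0 < r" "r < d" "r < \<eta> / 4" "\<zeta> / G * r = \<rho> * \<zeta>"
      using \<rho>(1) G \<rho>G unfolding r_def by auto
    have sub: "ball ts (\<rho> * \<zeta>) \<subseteq> ball t0 r"
    proof
      fix t assume "t \<in> ball ts (\<rho> * \<zeta>)"
      then have "\<bar>ts - t\<bar> < \<rho> * \<zeta>" by (simp add: dist_real_def)
      moreover have "r = 2 * H / \<Delta> * \<rho> + \<rho> * \<zeta>" unfolding r_def G_def by (simp add: algebra_simps)
      ultimately have "\<bar>t0 - t\<bar> < r" using tst0 by linarith
      then show "t \<in> ball t0 r" by (simp add: dist_real_def)
    qed
    have good: "clustered (2 / 3 * \<epsilon>) t" if t: "t \<in> ball ts (\<rho> * \<zeta>)" for t
    proof -
      have "t \<in> ball t0 r" using sub t by blast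
      then have tt0: "\<bar>t - t0\<bar> \<le> \<eta> / 4" using r(3) unfolding mem_ball dist_real_def by linarith
      have par: "\<bar>t * z - t0\<bar> \<le> \<eta>" if z: "\<bar>z - 1\<bar> < e" for z
      proof -
        have "t * z - t0 = (t - t0) * z + t0 * (z - 1)" by (simp add: algebra_simps)
        then have "\<bar>t * z - t0\<bar> \<le> \<bar>t - t0\<bar> * \<bar>z\<bar> + \<bar>t0\<bar> * \<bar>z - 1\<bar>"
          by (metis abs_mult abs_triangle_ineq)
        moreover have "\<bar>t - t0\<bar> * \<bar>z\<bar> \<le> \<eta> / 4 * 2" using tt0 z e(2) l(2) by (intro mult_mono) auto
        moreover have "\<bar>t0\<bar> * \<bar>z - 1\<bar> \<le> \<bar>t0\<bar> * e" using z by (intro mult_left_mono) auto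
        ultimately show ?thesis using et by linarith
      qed
      have aligned: "\<bar>(X.act u 0 + t * Y.act w 0 + X.slope u * c) - (X.act u' 0 + t * Y.act w' 0 + X.slope u' * c)\<bar>
          \<le> e * \<bar>X.slope u\<bar>"
      proof -
        have "(X.act u 0 + t * Y.act w 0 + X.slope u * c) - (X.act u' 0 + t * Y.act w' 0 + X.slope u' * c) = D0 + t * D"
          unfolding D0_def D_def by (simp add: algebra_simps)
        also have "\<dots> = (t - ts) * D" using ts by (simp add: algebra_simps)
        also have "\<bar>(t - ts) * D\<bar> \<le> (\<rho> * \<zeta>) * (3 / 2 * \<Delta>)"
          unfolding abs_mult using t D(2) \<rho>(1) \<zeta>(1) by (intro mult_mono) (auto simp: dist_real_def)
        also have "\<dots> = e * (\<sigma> * \<rho>)" using \<zeta>(2) by (simp add: mult_ac)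
        also have "\<dots> \<le> e * \<bar>X.slope u\<bar>" using su(1) e(1) by (intro mult_left_mono) auto
        finally show ?thesis .
      qed
      show ?thesis
        by (rule clustered_double[OF Q(1) l(1) \<epsilon> l(4) words split par[OF ratios(2)] par[OF ratios(3)] e(1,2) ratios aligned cost])
    qed
    show "\<exists>r c. 0 < r \<and> r < d \<and> ball c (\<zeta> / G * r) \<subseteq> ball t0 r \<and> (\<forall>t\<in>ball c (\<zeta> / G * r). clustered (2 / 3 * \<epsilon>) t)"
      using r sub good by (intro exI[of _ r] exI[of _ ts]) simp
  qed
qed

section \<open>Almost every parameter and angle\<close>

text \<open>
  The parameters at which two points of the product with different second coordinates have the same
  projection.  As \<open>x + t * y = x' + t * y\<close> only for \<open>x = x'\<close>, these are the parameters at which the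
  projection is not injective.
\<close>
definition meeting :: "real set" where
  "meeting = {t. \<exists>x\<in>C1. \<exists>x'\<in>C1. \<exists>y\<in>C2. \<exists>y'\<in>C2. y \<noteq> y' \<and> x + t * y = x' + t * y'}"

lemma clustered_large:
  obtains i :: nat where "0 < i" "clustered (real i) t"
proof -
  obtain L where L: "0 < L" "\<And>t. cell t [] [] \<subseteq> cball 0 (L * (1 + \<bar>t\<bar>))" using cell_subset_cball by blast
  define l where "l = L * (1 + \<bar>t\<bar>)"
  obtain i :: nat where i: "(2 * l) powr (d1 + d2) < real i" using reals_Archimedean2 by blast
  have "clustered (real i) t"
    unfolding clustered_def
  proof (intro exI conjI)
    show "{([], [])} \<subseteq> X.words 0 \<times> Y.words 0" by (simp add: X.words_0 Y.words_0)
    show "0 < l" unfolding l_def using L(1) by (intro mult_pos_pos) auto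
    show "\<forall>(u, w)\<in>{([], [])}. cell t u w \<subseteq> cball 0 l" using L(2)[of t] unfolding l_def by simp
    show "(2 * l) powr (d1 + d2) < real i * mass {([], [])}" using i by (simp add: mass_def)
  qed
  moreover have "0 < real i" using i by (meson le_less_trans powr_ge_zero)
  ultimately show ?thesis using that by simp
qed

lemma meeting_not_improved_negligible:
  assumes "0 < \<epsilon>"
  shows "negligible {t \<in> meeting. clustered \<epsilon> t \<and> \<not> clustered (2 / 3 * \<epsilon>) t}" (is "negligible ?S")
proof (rule porous_negligible)
  fix t0 assume t0: "t0 \<in> ?S"
  then obtain x x' y y' where pts: "x \<in> C1" "x' \<in> C1" "y \<in> C2" "y' \<in> C2" "y \<noteq> y'" and eq: "x + t0 * y = x' + t0 * y'"
    unfolding meeting_def by blast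
  have cl: "clustered \<epsilon> t0" using t0 by simp
  obtain k where k: "0 < k" "\<And>d. 0 < d \<Longrightarrow> \<exists>r c. 0 < r \<and> r < d \<and> ball c (k * r) \<subseteq> ball t0 r \<and>
      (\<forall>t\<in>ball c (k * r). clustered (2 / 3 * \<epsilon>) t)"
    using clustered_porous[OF cl assms pts eq] by blast
  show "\<exists>k>0. \<forall>d>0. \<exists>r c. 0 < r \<and> r < d \<and> ball c (k * r) \<subseteq> ball t0 r \<and> ball c (k * r) \<inter> ?S = {}"
  proof (rule exI[of _ k], intro conjI allI impI)
    show "0 < k" by (rule k(1))
    fix d :: real assume "0 < d"
    from k(2)[OF this] obtain r c where r: "0 < r" "r < d" "ball c (k * r) \<subseteq> ball t0 r"
      "\<forall>t\<in>ball c (k * r). clustered (2 / 3 * \<epsilon>) t" by blast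
    from r(4) have "ball c (k * r) \<inter> ?S = {}" by blast
    with r(1-3) show "\<exists>r c. 0 < r \<and> r < d \<and> ball c (k * r) \<subseteq> ball t0 r \<and> ball c (k * r) \<inter> ?S = {}"
      by (intro exI conjI)
  qed
qed

text \<open>
  Every parameter is \<open>\<epsilon>\<close>-clustered for some \<open>\<epsilon>\<close>, and for almost every parameter in \<^term>\<open>meeting\<close> this
  \<open>\<epsilon>\<close> can be multiplied by \<open>2 / 3\<close> as often as desired.  Only countably many null sets are involved.
\<close>
lemma almost_all_coverable:
  obtains Bad where "negligible Bad"
    "\<And>t \<delta> M. t \<in> meeting \<Longrightarrow> t \<notin> Bad \<Longrightarrow> 0 < \<delta> \<Longrightarrow> 0 < M \<Longrightarrow> coverable (d1 + d2) \<delta> M (cell t [] [])"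
proof -
  define S where "S \<epsilon> = {t \<in> meeting. clustered \<epsilon> t \<and> \<not> clustered (2 / 3 * \<epsilon>) t}" for \<epsilon>
  define Bad where "Bad = (\<Union>i. \<Union>j. S (real (Suc i) * (2/3) ^ j))"
  have neg: "negligible (S (real (Suc i) * (2/3) ^ j))" for i j :: nat
    unfolding S_def by (rule meeting_not_improved_negligible) simp
  show ?thesis
  proof (rule that[of Bad])
    show "negligible Bad" unfolding Bad_def by (intro negligible_Union_nat neg)
    fix t \<delta> M :: real assume t: "t \<in> meeting" "t \<notin> Bad" and \<delta>: "0 < \<delta>" and M: "0 < M"
    obtain i0 where "0 < i0" "clustered (real i0) t" by (rule clustered_large)
    then obtain i where i: "clustered (real (Suc i)) t" by (metis gr0_implies_Suc)
    have cl: "clustered (real (Suc i) * (2/3) ^ j) t" for j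
    proof (induction j)
      case (Suc j)
      have "t \<notin> S (real (Suc i) * (2/3) ^ j)" using t(2) unfolding Bad_def by blast
      then have "clustered (2 / 3 * (real (Suc i) * (2/3) ^ j)) t" using Suc t(1) unfolding S_def by blast
      then show ?case by (simp add: mult_ac)
    qed (use i in simp)
    have "0 < M / (3 * real (Suc i))" using M by simp
    then obtain j where j: "(2/3) ^ j < M / (3 * real (Suc i))" using real_arch_pow_inv[of _ "2/3"] by fastforce
    have "coverable (d1 + d2) \<delta> (3 * (real (Suc i) * (2/3) ^ j)) (cell t [] [])"
      by (rule clustered_coverable[OF cl _ \<delta>]) simp
    moreover have "3 * (real (Suc i) * (2/3) ^ j) \<le> M"
      using j by (simp add: pos_less_divide_eq mult_ac del: of_nat_Suc)
    ultimately show "coverable (d1 + d2) \<delta> M (cell t [] [])" by (rule coverable_mono[OF _ order.refl])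
  qed
qed

lemma hausdorff_measure_proj_zero:
  assumes c: "cos \<theta> \<noteq> 0"
    and cov: "\<And>\<delta> M. 0 < \<delta> \<Longrightarrow> 0 < M \<Longrightarrow> coverable (d1 + d2) \<delta> M (cell (tan \<theta>) [] [])"
  shows "hausdorff_measure (d1 + d2) (proj_line \<theta> ` (C1 \<times> C2)) = 0"
proof -
  define f where "f z = (z * cos \<theta>) *\<^sub>R (cos \<theta>, sin \<theta>)" for z :: real
  have nrm: "norm (cos \<theta>, sin \<theta>) = 1" by (simp add: norm_Pair)
  have lip: "dist (f x) (f y) \<le> dist x y" for x y
  proof -
    have "f x - f y = ((x - y) * cos \<theta>) *\<^sub>R (cos \<theta>, sin \<theta>)"
      unfolding f_def scaleR_diff_left[symmetric] by (simp add: algebra_simps)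
    then have "dist (f x) (f y) = \<bar>x - y\<bar> * \<bar>cos \<theta>\<bar>"
      unfolding dist_norm using nrm by (simp add: abs_mult del: scaleR_Pair)
    also have "\<dots> \<le> \<bar>x - y\<bar> * 1" using abs_cos_le_one by (intro mult_left_mono) auto
    finally show ?thesis by (simp add: dist_real_def)
  qed
  have img: "proj_line \<theta> ` (C1 \<times> C2) = f ` cell (tan \<theta>) [] []"
  proof -
    have "proj_line \<theta> (x, y) = f (proj (tan \<theta>) [] [] x y)" for x y
      using c unfolding proj_line_def f_def proj_def
      by (simp add: X.act_def Y.act_def tan_def field_simps)
    then show ?thesis unfolding cell_def by (force simp: image_iff)
  qed
  have "hausdorff_premeasure (d1 + d2) \<delta> (f ` cell (tan \<theta>) [] []) = 0" if "0 < \<delta>" for \<delta>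
  proof -
    have "hausdorff_premeasure (d1 + d2) \<delta> (f ` cell (tan \<theta>) [] []) \<le> 0"
    proof (rule ennreal_le_epsilon)
      fix M :: real assume "0 < M"
      have "0 \<le> d1 + d2" using X.dim_nonneg Y.dim_nonneg by simp
      from hausdorff_premeasure_image_le[OF cov[OF \<open>0 < \<delta>\<close> \<open>0 < M\<close>] this \<open>0 < \<delta>\<close> lip]
      show "hausdorff_premeasure (d1 + d2) \<delta> (f ` cell (tan \<theta>) [] []) \<le> 0 + ennreal M"
        by simp
    qed
    then show ?thesis by simp
  qed
  then show ?thesis unfolding hausdorff_measure_def img by (simp add: SUP_eq_const)
qed

lemma non_injective_imp_meeting:
  assumes "\<theta> \<in> non_injective_angles C1 C2" and c: "cos \<theta> \<noteq> 0"
  shows "tan \<theta> \<in> meeting"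
proof -
  obtain x y x' y' where p: "x \<in> C1" "x' \<in> C1" "y \<in> C2" "y' \<in> C2" "(x, y) \<noteq> (x', y')"
    "proj_line \<theta> (x, y) = proj_line \<theta> (x', y')"
    using assms(1) unfolding non_injective_angles_def inj_on_def by auto
  have "(cos \<theta>, sin \<theta>) \<noteq> 0" using c by (simp add: zero_prod_def)
  then have "(x, y) \<bullet> (cos \<theta>, sin \<theta>) = (x', y') \<bullet> (cos \<theta>, sin \<theta>)"
    using p(6) unfolding proj_line_def by (metis scaleR_cancel_right)
  then have "x * cos \<theta> + y * sin \<theta> = x' * cos \<theta> + y' * sin \<theta>" by simp
  then have eq: "x + tan \<theta> * y = x' + tan \<theta> * y'" using c by (simp add: tan_def field_simps)
  then have "y \<noteq> y'" using p(5) by auto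
  then show ?thesis using p eq unfolding meeting_def by blast
qed

end

text \<open>
  The tangent is inverted on \<open>[0, pi)\<close> by two branches of the arctangent, which are differentiable and so
  preserve null sets.
\<close>
lemma negligible_tan_preimage:
  assumes "negligible Bad"
  shows "negligible {\<theta> \<in> {0..<pi}. cos \<theta> = 0 \<or> tan \<theta> \<in> Bad}"
proof -
  have d: "(\<lambda>z. arctan z + c) differentiable_on Bad" for c
    unfolding differentiable_on_def
  proof
    fix z assume "z \<in> Bad"
    have "((\<lambda>z. arctan z + c) has_real_derivative inverse (1 + z\<^sup>2)) (at z within Bad)"
      by (auto intro!: derivative_eq_intros)
    then show "(\<lambda>z. arctan z + c) differentiable at z within Bad"
      by (metis has_field_derivative_imp_has_derivative differentiable_def)
  qed
  have neg: "negligible ((\<lambda>z. arctan z + c) ` Bad)" for c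
    by (rule negligible_differentiable_image_negligible[OF _ assms d]) simp
  have "negligible ({pi / 2} \<union> (\<lambda>z. arctan z + 0) ` Bad \<union> (\<lambda>z. arctan z + pi) ` Bad)"
    by (intro negligible_Un negligible_sing neg)
  moreover have "{\<theta> \<in> {0..<pi}. cos \<theta> = 0 \<or> tan \<theta> \<in> Bad}
      \<subseteq> {pi / 2} \<union> (\<lambda>z. arctan z + 0) ` Bad \<union> (\<lambda>z. arctan z + pi) ` Bad"
  proof
    fix \<theta> assume "\<theta> \<in> {\<theta> \<in> {0..<pi}. cos \<theta> = 0 \<or> tan \<theta> \<in> Bad}"
    then have \<theta>: "0 \<le> \<theta>" "\<theta> < pi" "cos \<theta> = 0 \<or> tan \<theta> \<in> Bad" by auto
    consider "\<theta> = pi / 2" | "\<theta> < pi / 2" | "pi / 2 < \<theta>" by linarith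
    then show "\<theta> \<in> {pi / 2} \<union> (\<lambda>z. arctan z + 0) ` Bad \<union> (\<lambda>z. arctan z + pi) ` Bad"
    proof cases
      case 2
      then have "cos \<theta> \<noteq> 0" using \<theta> cos_gt_zero_pi[of \<theta>] pi_gt_zero by linarith
      then have "tan \<theta> \<in> Bad" using \<theta>(3) by simp
      moreover have "\<theta> = arctan (tan \<theta>) + 0" using arctan_tan[of \<theta>] 2 \<theta>(1) pi_gt_zero by simp
      ultimately show ?thesis by blast
    next
      case 3
      then have "0 < cos (\<theta> - pi)" using \<theta> by (intro cos_gt_zero_pi) auto
      then have "cos \<theta> \<noteq> 0" by (simp add: cos_diff)
      then have "tan \<theta> \<in> Bad" using \<theta>(3) by simp
      moreover have "tan (\<theta> - pi) = tan \<theta>" by (simp add: tan_def cos_diff sin_diff)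
      then have "\<theta> = arctan (tan \<theta>) + pi" using arctan_tan[of "\<theta> - pi"] 3 \<theta>(2) by simp
      ultimately show ?thesis by blast
    qed simp
  qed
  ultimately show ?thesis by (rule negligible_subset)
qed

theorem theorem2p14:
  fixes A B :: nat
    and sg1 r1 b1 sg2 r2 b2 :: "nat \<Rightarrow> real"
    and d1 d2 :: real
    and C1 C2 :: "real set"
  assumes "affine_cantor_set A sg1 r1 b1 d1 C1"
    and "affine_cantor_set B sg2 r2 b2 d2 C2"
  shows "AE \<theta> in lebesgue. \<theta> \<in> non_injective_angles C1 C2 \<longrightarrow>
           hausdorff_measure (d1 + d2) (proj_line \<theta> ` (C1 \<times> C2)) = 0"
proof -
  interpret affine_ifs_pair A sg1 r1 b1 d1 C1 B sg2 r2 b2 d2 C2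
    by unfold_locales (fact assms)+
  obtain Bad where Bad: "negligible Bad"
    "\<And>t \<delta> M. t \<in> meeting \<Longrightarrow> t \<notin> Bad \<Longrightarrow> 0 < \<delta> \<Longrightarrow> 0 < M \<Longrightarrow> coverable (d1 + d2) \<delta> M (cell t [] [])"
    by (rule almost_all_coverable) (rule that)
  let ?N = "{\<theta> \<in> {0..<pi}. cos \<theta> = 0 \<or> tan \<theta> \<in> Bad}"
  have "?N \<in> null_sets lebesgue"
    using negligible_tan_preimage[OF Bad(1)] by (simp add: negligible_iff_null_sets)
  moreover have "hausdorff_measure (d1 + d2) (proj_line \<theta> ` (C1 \<times> C2)) = 0"
    if \<theta>: "\<theta> \<in> non_injective_angles C1 C2" "\<theta> \<notin> ?N" for \<theta>
  proof -
    have "\<theta> \<in> {0..<pi}" using \<theta>(1) unfolding non_injective_angles_def by simp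
    then have c: "cos \<theta> \<noteq> 0" and nb: "tan \<theta> \<notin> Bad" using \<theta>(2) by auto
    show ?thesis
      by (rule hausdorff_measure_proj_zero[OF c Bad(2)[OF non_injective_imp_meeting[OF \<theta>(1) c] nb]])
  qed
  ultimately show ?thesis by (intro AE_I'[of ?N]) auto
qed

end
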